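(* Let $s\in\mathbb{N}$ and $k\in\mathbb{Z}$. If $k\ne0$, the representer of $I_k$ in $H^s$, i.e. the function $h_{k,s}\in H^s$ with $I_k(f)=\langle f,h_{k,s}\rangle_s$ for all $f\in H^s$, is $$h_{k,s}(x)=(2\pi k)^{-2s}\,e^{2\pi i kx}-\sum_{\ell=1}^s(-1)^\ell(2\pi i k)^{-\ell}\,B_\ell^*(x),$$ and the initial error is $$e(0,k,s)=\|h_{k,s}\|_{H^s}=\sqrt{\frac{2}{(2\pi k)^{2s}}+\sum_{\ell=1}^{s-1}\frac1{(2\pi k)^{2\ell}}}=\frac{\beta_{k,s}}{2\pi|k|}$$ with $\beta_{k,1}=\sqrt2$ and, for $s>1$, $$1\le\beta_{k,s}=\sqrt{\frac{(2\pi k)^{2s}+(2\pi k)^2-2}{(2\pi k)^{2s}-(2\pi k)^{2(s-1)}}}\le\sqrt{1+\frac{2}{(2\pi k)^2-1}}\le1.02566,$$ and $\lim_{k\to\infty}\beta_{k,s}=1$ for $s>1$. For $k=0$, the representer is $h_{0,s}=1$ and the initial error is $e(0,0,s)=1$.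
   Context: For $s\in\mathbb{N}=\{1,2,\dots\}$ let $H^s=\{f:[0,1]\to\mathbb{C} : f^{(s-1)}\text{ is absolutely continuous},\ f^{(s)}\in L_2([0,1])\}$ with inner product $$\langle f,g\rangle_s=\sum_{\ell=0}^{s-1}\int_0^1 f^{(\ell)}(x)\,dx\ \int_0^1\overline{g^{(\ell)}(x)}\,dx+\int_0^1 f^{(s)}(x)\,\overline{g^{(s)}(x)}\,dx$$ and norm $\|f\|_{H^s}=\langle f,f\rangle_s^{1/2}$. For $k\in\mathbb{Z}$, $I_k(f)=\int_0^1 f(x)\,e^{-2\pi i kx}\,dx$, and the initial error is $e(0,k,s)=\sup\{|I_k(f)| : f\in H^s,\ \|f\|_{H^s}\le1\}$. $B_\ell^*=B_\ell/\ell!$ is the normalized Bernoulli polynomial, where $B_\ell$ is the Bernoulli polynomial of degree $\ell$, the unique polynomial with $\int_t^{t+1}B_\ell(x)\,dx=t^\ell$ for all $t\in\mathbb{R}$ (with $0^0=1$). *)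

theory Defs
  imports "HOL-Analysis.Analysis" "HOL-Computational_Algebra.Polynomial"
begin

text \<open>
  Functions on the unit interval are represented by total functions on the reals. All notions
  below depend only on the values on the unit interval; in particular derivatives are taken
  within it, hence are one-sided at the endpoints.
\<close>

abbreviation unit_interval :: "real set"
  where "unit_interval \<equiv> {0..1}"

abbreviation unit_measure :: "real measure"
  where "unit_measure \<equiv> lebesgue_on unit_interval"

primrec nderiv :: "nat \<Rightarrow> (real \<Rightarrow> complex) \<Rightarrow> real \<Rightarrow> complex"
  where
    "nderiv 0 f = f"
  | "nderiv (Suc n) f = (\<lambda>x. vector_derivative (nderiv n f) (at x within unit_interval))"

text \<open>
  A finite family of nonoverlapping compact subintervals of \<^term>\<open>S\<close> is given as a division \<^term>\<open>D\<close>
  of its union; the endpoints of a member \<^term>\<open>K\<close> are its infimum and supremum.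
\<close>

definition abs_continuous_on :: "real set \<Rightarrow> (real \<Rightarrow> complex) \<Rightarrow> bool"
  where "abs_continuous_on S f \<longleftrightarrow>
    (\<forall>\<epsilon>>0. \<exists>\<delta>>0. \<forall>D. D division_of \<Union>D \<and> \<Union>D \<subseteq> S \<and> (\<Sum>K\<in>D. Sup K - Inf K) < \<delta>
       \<longrightarrow> (\<Sum>K\<in>D. norm (f (Sup K) - f (Inf K))) < \<epsilon>)"

definition L2 :: "(real \<Rightarrow> complex) set"
  where "L2 = {f \<in> borel_measurable unit_measure. integrable unit_measure (\<lambda>x. (norm (f x))\<^sup>2)}"

text \<open>
  For positive \<^term>\<open>s\<close>. The third condition follows from the second one by Lebesgue's
  differentiation theorem. It is stated because the derivative of order \<^term>\<open>s\<close> in the last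
  condition is defined only almost everywhere, whereas \<^const>\<open>vector_derivative\<close> is a total function.
\<close>

definition sobolev :: "nat \<Rightarrow> (real \<Rightarrow> complex) set"
  where "sobolev s = {f.
    (\<forall>j<s - 1. \<forall>x\<in>unit_interval. nderiv j f differentiable (at x within unit_interval)) \<and>
    abs_continuous_on unit_interval (nderiv (s - 1) f) \<and>
    (AE x in unit_measure. nderiv (s - 1) f differentiable (at x within unit_interval)) \<and>
    nderiv s f \<in> L2}"

definition sobolev_inner :: "nat \<Rightarrow> (real \<Rightarrow> complex) \<Rightarrow> (real \<Rightarrow> complex) \<Rightarrow> complex"
  where "sobolev_inner s f g =
    (\<Sum>l<s. (LINT x|unit_measure. nderiv l f x) * (LINT x|unit_measure. cnj (nderiv l g x)))
    + (LINT x|unit_measure. nderiv s f x * cnj (nderiv s g x))"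

definition sobolev_norm :: "nat \<Rightarrow> (real \<Rightarrow> complex) \<Rightarrow> real"
  where "sobolev_norm s f = sqrt (Re (sobolev_inner s f f))"

definition fourier_coeff :: "int \<Rightarrow> (real \<Rightarrow> complex) \<Rightarrow> complex"
  where "fourier_coeff k f =
    (LINT x|unit_measure. f x * exp (- 2 * of_real pi * \<i> * of_int k * of_real x))"

text \<open>The supremum is extended real-valued, so that it does not presuppose boundedness.\<close>

definition initial_error :: "int \<Rightarrow> nat \<Rightarrow> ereal"
  where "initial_error k s =
    (SUP f\<in>{f \<in> sobolev s. sobolev_norm s f \<le> 1}. ereal (cmod (fourier_coeff k f)))"

definition is_representer :: "int \<Rightarrow> nat \<Rightarrow> (real \<Rightarrow> complex) \<Rightarrow> bool"
  where "is_representer k s h \<longleftrightarrow>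
    h \<in> sobolev s \<and> (\<forall>f\<in>sobolev s. fourier_coeff k f = sobolev_inner s f h)"

definition bernoulli_poly :: "nat \<Rightarrow> real poly"
  where "bernoulli_poly l = (THE p. \<forall>t::real. (poly p has_integral t ^ l) {t..t + 1})"

definition normalized_bernoulli :: "nat \<Rightarrow> real \<Rightarrow> real"
  where "normalized_bernoulli l x = poly (bernoulli_poly l) x / fact l"

definition beta_const :: "int \<Rightarrow> nat \<Rightarrow> real"
  where "beta_const k s =
    (if s = 1 then sqrt 2
     else sqrt (((2 * pi * of_int k) ^ (2 * s) + (2 * pi * of_int k)\<^sup>2 - 2)
       / ((2 * pi * of_int k) ^ (2 * s) - (2 * pi * of_int k) ^ (2 * (s - 1)))))"

end

theory Submission
  imports Defs
begin

text \<open>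
  Put \<open>\<omega> = 2 * pi * \<i> * k\<close> with \<open>k \<noteq> 0\<close>, and write \<open>f\<^sub>j\<close> for the derivative of order \<open>j\<close>
  of \<open>f\<close>. The function \<open>exp (- \<omega> * x)\<close> has period one, so integration by parts reads
  \<open>\<omega> * (\<integral> f\<^sub>j(x) * exp (- \<omega> * x)) = (\<integral> f\<^sub>j\<^sub>+\<^sub>1(x) * exp (- \<omega> * x)) - (\<integral> f\<^sub>j\<^sub>+\<^sub>1(x))\<close>,
  the last integral being the boundary term. After \<open>s\<close> steps the Fourier coefficient of \<open>f\<close> is
  expressed by the means of \<open>f\<^sub>1, ..., f\<^sub>s\<close> and by the Fourier coefficient of \<open>f\<^sub>s\<close>
  (\<open>fourier_integral_expansion\<close>). An inner product of \<open>f\<close> with \<open>h\<close> has exactly this form, so it remains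
  to find a function \<open>h\<close> whose derivatives of order below \<open>s\<close> have prescribed means and whose derivative
  of order \<open>s\<close> is a prescribed multiple of \<open>exp (\<omega> * x) - 1\<close>. Normalized Bernoulli polynomials are
  derivatives of each other and have mean zero except in degree 0, so they adjust these means one
  by one (\<open>integral_representer_deriv\<close>, \<open>representer_deriv_top\<close>, \<open>is_representer_bernoulli\<close>).

  The rest is Hilbert space geometry. The inner product is definite (\<open>sobolev_norm_eq_0D\<close>), so a
  representer is unique on the unit interval; by the Cauchy-Schwarz inequality the initial error is
  the norm of the representer (\<open>initial_error_eq_representer_norm\<close>). That norm is read off from the means
  and the top derivative, and a geometric sum turns it into the closed form.

  The analytic foundation is the fundamental theorem of calculus for absolutely continuous functions
  whose derivative exists almost everywhere (\<open>abs_continuous_on_fundamental_theorem\<close>). It yields the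
  integration by parts as well as the definiteness of the inner product.
\<close>

section \<open>Absolutely continuous functions\<close>

lemma abs_continuous_on_subset:
  assumes "abs_continuous_on S F" "T \<subseteq> S"
  shows "abs_continuous_on T F"
  unfolding abs_continuous_on_def
proof (intro allI impI)
  fix \<epsilon> :: real assume "\<epsilon> > 0"
  then obtain \<delta> where "\<delta> > 0" and \<delta>: "\<And>D. D division_of \<Union>D \<and> \<Union>D \<subseteq> S \<and> (\<Sum>K\<in>D. Sup K - Inf K) < \<delta>
       \<Longrightarrow> (\<Sum>K\<in>D. norm (F (Sup K) - F (Inf K))) < \<epsilon>"
    using assms(1) unfolding abs_continuous_on_def by meson
  with assms(2) show "\<exists>\<delta>>0. \<forall>D. D division_of \<Union>D \<and> \<Union>D \<subseteq> T \<and> (\<Sum>K\<in>D. Sup K - Inf K) < \<delta>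
       \<longrightarrow> (\<Sum>K\<in>D. norm (F (Sup K) - F (Inf K))) < \<epsilon>"
    by (meson subset_trans)
qed

lemma division_of_real_bounds:
  fixes K :: "real set"
  assumes "D division_of S" "K \<in> D"
  shows "Inf K \<in> S" "Sup K \<in> S" "Inf K \<le> Sup K"
proof -
  obtain u v where K: "K = {u..v}" "K \<noteq> {}"
    using division_ofD(3,4)[OF assms] by (metis box_real(2))
  moreover have "K \<subseteq> S"
    using division_ofD(2)[OF assms] .
  ultimately show "Inf K \<in> S" "Sup K \<in> S" "Inf K \<le> Sup K"
    by auto
qed

text \<open>
  Every closure property of absolute continuity below is an instance of this comparison: the
  increments of a combination of two functions are controlled by theirs.
\<close>
lemma abs_continuous_on_dominated:
  assumes F: "abs_continuous_on S F" and G: "abs_continuous_on S G" and C: "C \<ge> 0"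
    and le: "\<And>x y. \<lbrakk>x \<in> S; y \<in> S\<rbrakk> \<Longrightarrow>
      norm (H y - H x) \<le> C * (norm (F y - F x) + norm (G y - G x))"
  shows "abs_continuous_on S H"
  unfolding abs_continuous_on_def
proof (intro allI impI)
  fix \<epsilon> :: real assume "\<epsilon> > 0"
  define \<eta> where "\<eta> = \<epsilon> / (C + 1) / 2"
  have "\<eta> > 0"
    using \<open>\<epsilon> > 0\<close> C by (simp add: \<eta>_def)
  obtain \<delta>1 where "\<delta>1 > 0" and \<delta>1: "\<And>D. D division_of \<Union>D \<and> \<Union>D \<subseteq> S \<and> (\<Sum>K\<in>D. Sup K - Inf K) < \<delta>1
       \<Longrightarrow> (\<Sum>K\<in>D. norm (F (Sup K) - F (Inf K))) < \<eta>"
    using F \<open>\<eta> > 0\<close> unfolding abs_continuous_on_def by meson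
  obtain \<delta>2 where "\<delta>2 > 0" and \<delta>2: "\<And>D. D division_of \<Union>D \<and> \<Union>D \<subseteq> S \<and> (\<Sum>K\<in>D. Sup K - Inf K) < \<delta>2
       \<Longrightarrow> (\<Sum>K\<in>D. norm (G (Sup K) - G (Inf K))) < \<eta>"
    using G \<open>\<eta> > 0\<close> unfolding abs_continuous_on_def by meson
  have "(\<Sum>K\<in>D. norm (H (Sup K) - H (Inf K))) < \<epsilon>"
    if D: "D division_of \<Union>D" "\<Union>D \<subseteq> S" "(\<Sum>K\<in>D. Sup K - Inf K) < min \<delta>1 \<delta>2" for D
  proof -
    have "(\<Sum>K\<in>D. norm (H (Sup K) - H (Inf K)))
        \<le> (\<Sum>K\<in>D. C * (norm (F (Sup K) - F (Inf K)) + norm (G (Sup K) - G (Inf K))))"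
      using division_of_real_bounds[OF D(1)] D(2) by (intro sum_mono le) blast+
    also have "\<dots> = C * ((\<Sum>K\<in>D. norm (F (Sup K) - F (Inf K))) + (\<Sum>K\<in>D. norm (G (Sup K) - G (Inf K))))"
      by (simp add: sum_distrib_left sum.distrib distrib_left)
    also have "\<dots> \<le> C * (\<eta> + \<eta>)"
      using \<delta>1[of D] \<delta>2[of D] D C by (intro mult_left_mono add_mono) auto
    also have "\<eta> + \<eta> = \<epsilon> / (C + 1)"
      unfolding \<eta>_def by (rule field_sum_of_halves)
    also have "C * (\<epsilon> / (C + 1)) < \<epsilon>"
      using C \<open>\<epsilon> > 0\<close> by (simp add: field_simps)
    finally show ?thesis .
  qed
  then show "\<exists>\<delta>>0. \<forall>D. D division_of \<Union>D \<and> \<Union>D \<subseteq> S \<and> (\<Sum>K\<in>D. Sup K - Inf K) < \<delta>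
       \<longrightarrow> (\<Sum>K\<in>D. norm (H (Sup K) - H (Inf K))) < \<epsilon>"
    using \<open>\<delta>1 > 0\<close> \<open>\<delta>2 > 0\<close> by (intro exI[of _ "min \<delta>1 \<delta>2"]) auto
qed

text \<open>
  The increments of the identity add up to the total length of the intervals, and the
  increments of a Lipschitz function are dominated by those of the identity.
\<close>
lemma abs_continuous_on_lipschitz:
  assumes "L-lipschitz_on S F"
  shows "abs_continuous_on S F"
proof -
  have id: "abs_continuous_on S of_real"
    unfolding abs_continuous_on_def
  proof (intro allI impI)
    fix \<epsilon> :: real assume "\<epsilon> > 0"
    have "(\<Sum>K\<in>D. norm (complex_of_real (Sup K) - of_real (Inf K))) = (\<Sum>K\<in>D. Sup K - Inf K)"
      if "D division_of \<Union>D" for D :: "real set set"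
      using division_of_real_bounds(3)[OF that]
      by (intro sum.cong) (auto simp flip: of_real_diff)
    then show "\<exists>\<delta>>0. \<forall>D. D division_of \<Union>D \<and> \<Union>D \<subseteq> S \<and> (\<Sum>K\<in>D. Sup K - Inf K) < \<delta>
       \<longrightarrow> (\<Sum>K\<in>D. norm (complex_of_real (Sup K) - of_real (Inf K))) < \<epsilon>"
      using \<open>\<epsilon> > 0\<close> by (intro exI[of _ \<epsilon>]) auto
  qed
  \<comment> \<open>The comparison lemma wants two dominating functions; the identity serves as both.\<close>
  show ?thesis
  proof (rule abs_continuous_on_dominated[OF id id lipschitz_on_nonneg[OF assms]])
    fix x y assume "x \<in> S" "y \<in> S"
    then have "norm (F y - F x) \<le> L * \<bar>y - x\<bar>"
      using lipschitz_onD[OF assms, of y x] by (simp add: dist_norm)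
    also have "\<dots> \<le> L * (\<bar>y - x\<bar> + \<bar>y - x\<bar>)"
      using lipschitz_on_nonneg[OF assms] by (intro mult_left_mono) auto
    also have "\<dots> = L * (norm (complex_of_real y - of_real x) + norm (complex_of_real y - of_real x))"
      by (simp flip: of_real_diff)
    finally show "norm (F y - F x) \<le> \<dots>" .
  qed
qed

lemma abs_continuous_on_imp_continuous_on:
  assumes F: "abs_continuous_on {a..b} F"
  shows "continuous_on {a..b} F"
  unfolding continuous_on_iff
proof (intro ballI allI impI)
  fix x and \<epsilon> :: real assume x: "x \<in> {a..b}" and "\<epsilon> > 0"
  then obtain \<delta> where "\<delta> > 0" and \<delta>: "\<And>D. D division_of \<Union>D \<and> \<Union>D \<subseteq> {a..b} \<and> (\<Sum>K\<in>D. Sup K - Inf K) < \<delta>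
       \<Longrightarrow> (\<Sum>K\<in>D. norm (F (Sup K) - F (Inf K))) < \<epsilon>"
    using F unfolding abs_continuous_on_def by meson
  have le: "norm (F v - F u) < \<epsilon>" if "u \<in> {a..b}" "v \<in> {a..b}" "u \<le> v" "v - u < \<delta>" for u v
  proof -
    have "{{u..v}} division_of \<Union>{{u..v}}"
      using division_of_self[of u v] that by simp
    with \<delta>[of "{{u..v}}"] that show ?thesis
      by auto
  qed
  have "dist (F y) (F x) < \<epsilon>" if "y \<in> {a..b}" "dist y x < \<delta>" for y
    using le[of x y] le[of y x] that x
    by (cases "x \<le> y") (auto simp: dist_norm norm_minus_commute)
  with \<open>\<delta> > 0\<close> show "\<exists>d>0. \<forall>x'\<in>{a..b}. dist x' x < d \<longrightarrow> dist (F x') (F x) < \<epsilon>"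
    by blast
qed

lemma abs_continuous_on_mult:
  assumes F: "abs_continuous_on {a..b} F" and G: "abs_continuous_on {a..b} G"
  shows "abs_continuous_on {a..b} (\<lambda>x. F x * G x)"
proof -
  have "bounded (F ` {a..b})" "bounded (G ` {a..b})"
    using F G by (auto intro!: compact_imp_bounded compact_continuous_image
        abs_continuous_on_imp_continuous_on)
  then obtain A B where A: "\<And>x. x \<in> {a..b} \<Longrightarrow> norm (F x) \<le> A" and B: "\<And>x. x \<in> {a..b} \<Longrightarrow> norm (G x) \<le> B"
    unfolding bounded_iff by (metis imageI)
  show ?thesis
  proof (rule abs_continuous_on_dominated[OF F G])
    show "max 0 (max A B) \<ge> 0" by simp
    fix x y assume "x \<in> {a..b}" "y \<in> {a..b}"
    have "norm (F y * G y - F x * G x) = norm ((F y - F x) * G y + F x * (G y - G x))"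
      by (simp add: algebra_simps)
    also have "\<dots> \<le> norm (F y - F x) * norm (G y) + norm (F x) * norm (G y - G x)"
      by (metis norm_triangle_ineq norm_mult)
    also have "\<dots> \<le> norm (F y - F x) * max 0 (max A B) + max 0 (max A B) * norm (G y - G x)"
      using A[OF \<open>x \<in> {a..b}\<close>] B[OF \<open>y \<in> {a..b}\<close>]
      by (intro add_mono mult_left_mono mult_right_mono) auto
    finally show "norm (F y * G y - F x * G x)
        \<le> max 0 (max A B) * (norm (F y - F x) + norm (G y - G x))"
      by (simp add: algebra_simps)
  qed
qed

lemma abs_continuous_on_add_scaled:
  assumes F: "abs_continuous_on S F" and G: "abs_continuous_on S G"
  shows "abs_continuous_on S (\<lambda>x. F x + c * G x)"
proof (rule abs_continuous_on_dominated[OF F G])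
  show "1 + norm c \<ge> 0" by simp
  fix x y
  have "norm (F y + c * G y - (F x + c * G x)) = norm ((F y - F x) + c * (G y - G x))"
    by (simp add: algebra_simps)
  also have "\<dots> \<le> norm (F y - F x) + norm c * norm (G y - G x)"
    by (metis norm_triangle_ineq norm_mult)
  also have "\<dots> \<le> (1 + norm c) * (norm (F y - F x) + norm (G y - G x))"
    by (simp add: algebra_simps)
  finally show "norm (F y + c * G y - (F x + c * G x)) \<le> \<dots>" .
qed

lemma abs_continuous_on_C1:
  assumes F: "\<And>x. x \<in> {a..b} \<Longrightarrow> (F has_vector_derivative f x) (at x within {a..b})"
    and f: "continuous_on {a..b} f"
  shows "abs_continuous_on {a..b} F"
proof -
  have "bounded (f ` {a..b})"
    using f by (auto intro!: compact_imp_bounded compact_continuous_image)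
  then obtain B where B: "B > 0" "\<And>x. x \<in> {a..b} \<Longrightarrow> norm (f x) \<le> B"
    by (auto simp: bounded_pos)
  show ?thesis
  proof (rule abs_continuous_on_lipschitz)
    show "B-lipschitz_on {a..b} F"
    proof (rule bounded_derivative_imp_lipschitz)
      show "(F has_derivative (\<lambda>h. h *\<^sub>R f x)) (at x within {a..b})" if "x \<in> {a..b}" for x
        using F[OF that] by (simp add: has_vector_derivative_def)
      show "onorm (\<lambda>h. h *\<^sub>R f x) \<le> B" if "x \<in> {a..b}" for x
        using B(2)[OF that] by (intro onorm_le) (simp add: mult.commute[of B] mult_left_mono)
    qed (use B in auto)
  qed
qed

text \<open>
  The derivative is known only outside a null set, and it may be replaced by zero there. The proof
  then works directly with the gauge integral. Take a fine tagged division. Intervals with a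
  regular tag \<open>x\<close> contribute little, as the increment of \<open>F\<close> is nearly \<open>f x\<close> times the length.
  The intervals tagged inside the null set have small total length, because the integral of its
  indicator function is zero; hence absolute continuity bounds the increments of \<open>F\<close> over
  them, and they contribute nothing to the Riemann sum.
\<close>
lemma abs_continuous_on_fundamental_theorem:
  assumes "a \<le> b" and AC: "abs_continuous_on {a..b} F" and N: "negligible N"
    and deriv: "\<And>x. x \<in> {a..b} - N \<Longrightarrow> (F has_vector_derivative f x) (at x within {a..b})"
  shows "(f has_integral F b - F a) {a..b}"
proof -
  define g where "g = (\<lambda>x. if x \<in> N then 0 else f x)"
  have "(g has_integral F b - F a) (cbox a b)"
    unfolding has_integral
  proof (intro allI impI)
    fix e :: real assume "e > 0"
    \<comment> \<open>The regular intervals have total length \<open>b - a\<close>; the summand 1 only keeps the divisor positive.\<close>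
    define e' where "e' = e / (2 * (b - a + 1))"
    have "e' > 0" and e': "e' * (b - a) \<le> e / 2"
      using \<open>e > 0\<close> \<open>a \<le> b\<close> by (simp_all add: e'_def field_simps)
    have "\<forall>x. \<exists>d>0. x \<in> {a..b} - N \<longrightarrow>
        (\<forall>y\<in>{a..b}. norm (y - x) < d \<longrightarrow> norm (F y - F x - (y - x) *\<^sub>R f x) \<le> e' * norm (y - x))"
      using deriv[unfolded has_vector_derivative_def has_derivative_within_alt] \<open>e' > 0\<close>
      by (meson zero_less_one)
    then obtain d where d: "\<And>x. 0 < d x"
      "\<And>x y. \<lbrakk>x \<in> {a..b} - N; y \<in> {a..b}; norm (y - x) < d x\<rbrakk>
          \<Longrightarrow> norm (F y - F x - (y - x) *\<^sub>R f x) \<le> e' * norm (y - x)"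
      by metis
    obtain \<delta> where "\<delta> > 0" and \<delta>: "\<And>D. \<lbrakk>D division_of \<Union>D; \<Union>D \<subseteq> {a..b}; (\<Sum>K\<in>D. Sup K - Inf K) < \<delta>\<rbrakk>
       \<Longrightarrow> (\<Sum>K\<in>D. norm (F (Sup K) - F (Inf K))) < e / 2"
      using AC half_gt_zero[OF \<open>e > 0\<close>] unfolding abs_continuous_on_def by meson
    have "(indicat_real N has_integral 0) (cbox a b)"
      using N by (simp add: negligible_def)
    then obtain \<gamma> where "gauge \<gamma>" and
      \<gamma>: "\<And>p. \<lbrakk>p tagged_division_of cbox a b; \<gamma> fine p\<rbrakk>
          \<Longrightarrow> \<bar>\<Sum>(x,K)\<in>p. measure lborel K *\<^sub>R indicat_real N x\<bar> < \<delta>"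
      using \<open>\<delta> > 0\<close> unfolding has_integral by auto
    show "\<exists>\<gamma>. gauge \<gamma> \<and> (\<forall>p. p tagged_division_of cbox a b \<and> \<gamma> fine p \<longrightarrow>
        norm ((\<Sum>(x,K)\<in>p. measure lborel K *\<^sub>R g x) - (F b - F a)) < e)"
    proof (intro exI[of _ "\<lambda>x. \<gamma> x \<inter> ball x (d x)"] conjI allI impI)
      show "gauge (\<lambda>x. \<gamma> x \<inter> ball x (d x))"
        using \<open>gauge \<gamma>\<close> d(1) by (simp add: gauge_Int gauge_ball_dependent)
      fix p assume "p tagged_division_of cbox a b \<and> (\<lambda>x. \<gamma> x \<inter> ball x (d x)) fine p"
      then have p: "p tagged_division_of cbox a b" and fine1: "\<gamma> fine p"
        and fine2: "(\<lambda>x. ball x (d x)) fine p"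
        by (auto simp: fine_Int)
      define q where "q = {(x,K) \<in> p. x \<in> N}"
      have "finite p" "q \<subseteq> p"
        using p by (auto simp: q_def)
      have pK: "\<exists>u v. K = {u..v} \<and> u \<le> v \<and> u \<in> {a..b} \<and> v \<in> {a..b} \<and> x \<in> {u..v}" if xK: "(x,K) \<in> p" for x K
      proof -
        obtain u v where "K = cbox u v" "x \<in> K" "K \<subseteq> cbox a b"
          using tagged_division_ofD(2-4)[OF p xK] by blast
        then show ?thesis
          by (intro exI[of _ u] exI[of _ v]) auto
      qed
      have ba: "b - a = (\<Sum>(x,K)\<in>p. Sup K - Inf K)" "F b - F a = (\<Sum>(x,K)\<in>p. F (Sup K) - F (Inf K))"
        using additive_tagged_division_1[where f= "\<lambda>x. x"] additive_tagged_division_1[where f= F]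
              \<open>a \<le> b\<close> p by auto
      have q: "q tagged_division_of \<Union>(snd ` q)"
      proof (rule tagged_partial_division_of_Union_self)
        show "q tagged_partial_division_of cbox a b"
          using p \<open>q \<subseteq> p\<close> tagged_partial_division_subset unfolding tagged_division_of_def by metis
      qed
      have sum_q: "(\<Sum>(x,K)\<in>q. h (Sup K) (Inf K)) = (\<Sum>K\<in>snd ` q. h (Sup K) (Inf K))"
        if "\<And>u. h u u = 0" for h :: "real \<Rightarrow> real \<Rightarrow> real"
      proof -
        \<comment> \<open>The lemma on sums over divisions asks for the value 0 also at the empty interval, whose endpoints are default values.\<close>
        define d where "d = (\<lambda>K. if K = {} then 0 else h (Sup K) (Inf K))"
        have "(\<Sum>(x,K)\<in>q. d K) = (\<Sum>K\<in>snd ` q. d K)"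
        proof (rule sum.over_tagged_division_lemma[OF q])
          fix u v :: real assume "box u v = {}"
          then show "d (cbox u v) = 0"
            using that by (cases "u = v") (auto simp: d_def)
        qed
        moreover have "K \<noteq> {}" if "(x,K) \<in> q" for x K
          using pK[of x K] that \<open>q \<subseteq> p\<close> by auto
        then have "(\<Sum>(x,K)\<in>q. d K) = (\<Sum>(x,K)\<in>q. h (Sup K) (Inf K))"
          "(\<Sum>K\<in>snd ` q. d K) = (\<Sum>K\<in>snd ` q. h (Sup K) (Inf K))"
          by (auto intro!: sum.cong simp: d_def)
        ultimately show ?thesis by simp
      qed
      \<comment> \<open>The total length of the exceptional intervals is a Riemann sum of the indicator of \<open>N\<close>.\<close>
      have "(\<Sum>(x,K)\<in>q. Sup K - Inf K) = (\<Sum>(x,K)\<in>q. measure lborel K *\<^sub>R indicat_real N x)"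
        using pK \<open>q \<subseteq> p\<close> by (intro sum.cong) (fastforce simp: q_def)+
      also have "\<dots> = (\<Sum>(x,K)\<in>p. measure lborel K *\<^sub>R indicat_real N x)"
        using \<open>finite p\<close> \<open>q \<subseteq> p\<close> by (intro sum.mono_neutral_left) (auto simp: q_def indicator_def)
      also have "\<dots> < \<delta>"
        using \<gamma>[OF p fine1] by simp
      finally have "(\<Sum>K\<in>snd ` q. Sup K - Inf K) < \<delta>"
        using sum_q[of "\<lambda>u v. u - v"] by simp
      moreover have "\<Union>(snd ` q) \<subseteq> {a..b}"
        using pK \<open>q \<subseteq> p\<close> by fastforce
      ultimately have "(\<Sum>K\<in>snd ` q. norm (F (Sup K) - F (Inf K))) < e / 2"
        using \<delta> division_of_tagged_division[OF q] by blast
      then have small_q: "(\<Sum>(x,K)\<in>q. norm (F (Sup K) - F (Inf K))) < e / 2"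
        using sum_q[of "\<lambda>u v. norm (F u - F v)"] by simp
      have regular: "norm (measure lborel K *\<^sub>R g x - (F (Sup K) - F (Inf K))) \<le> e' * (Sup K - Inf K)"
        if "(x,K) \<in> p - q" for x K
      proof -
        from that have xK: "(x,K) \<in> p" and "x \<notin> N"
          by (auto simp: q_def)
        obtain u v where K: "K = {u..v}" and uv: "u \<le> v" "u \<in> {a..b}" "v \<in> {a..b}" "x \<in> {u..v}"
          using pK[OF xK] by blast
        have "K \<subseteq> ball x (d x)"
          using fine2 xK by blast
        moreover have "u \<in> K" "v \<in> K"
          using uv by (auto simp: K)
        ultimately have "u \<in> ball x (d x)" "v \<in> ball x (d x)"
          by auto
        then have close: "norm (u - x) < d x" "norm (v - x) < d x"
          by (auto simp: dist_real_def)
        have "x \<in> {a..b} - N"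
          using uv \<open>x \<notin> N\<close> by auto
        note d(2)[OF this uv(2) close(1)] d(2)[OF this uv(3) close(2)]
        moreover have "norm ((v - u) *\<^sub>R f x - (F v - F u))
            \<le> norm (F u - F x - (u - x) *\<^sub>R f x) + norm (F v - F x - (v - x) *\<^sub>R f x)"
          using norm_triangle_ineq4[of "F u - F x - (u - x) *\<^sub>R f x" "F v - F x - (v - x) *\<^sub>R f x"]
          by (simp add: algebra_simps)
        moreover have "e' * norm (u - x) + e' * norm (v - x) = e' * (v - u)"
          using uv by (simp add: algebra_simps)
        ultimately show ?thesis
          using uv \<open>x \<notin> N\<close> by (simp add: K g_def)
      qed
      have "(\<Sum>(x,K)\<in>p. measure lborel K *\<^sub>R g x) - (F b - F a)
          = (\<Sum>(x,K)\<in>p. measure lborel K *\<^sub>R g x - (F (Sup K) - F (Inf K)))"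
        unfolding ba(2) by (simp add: split_def sum_subtractf)
      also have "\<dots> = (\<Sum>(x,K)\<in>p - q. measure lborel K *\<^sub>R g x - (F (Sup K) - F (Inf K)))
          + (\<Sum>(x,K)\<in>q. measure lborel K *\<^sub>R g x - (F (Sup K) - F (Inf K)))"
        by (rule sum.subset_diff[OF \<open>q \<subseteq> p\<close> \<open>finite p\<close>])
      finally have split: "norm ((\<Sum>(x,K)\<in>p. measure lborel K *\<^sub>R g x) - (F b - F a))
          \<le> norm (\<Sum>(x,K)\<in>p - q. measure lborel K *\<^sub>R g x - (F (Sup K) - F (Inf K)))
            + norm (\<Sum>(x,K)\<in>q. measure lborel K *\<^sub>R g x - (F (Sup K) - F (Inf K)))"
        by (simp only: norm_triangle_ineq)
      have "norm (\<Sum>(x,K)\<in>p - q. measure lborel K *\<^sub>R g x - (F (Sup K) - F (Inf K)))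
          \<le> (\<Sum>(x,K)\<in>p - q. e' * (Sup K - Inf K))"
        by (rule sum_norm_le) (use regular in auto)
      also have "\<dots> \<le> (\<Sum>(x,K)\<in>p. e' * (Sup K - Inf K))"
        using pK \<open>e' > 0\<close> by (intro sum_mono2 \<open>finite p\<close>) fastforce+
      also have "\<dots> = e' * (b - a)"
        unfolding ba(1) by (simp add: split_def sum_distrib_left)
      finally have 1: "norm (\<Sum>(x,K)\<in>p - q. measure lborel K *\<^sub>R g x - (F (Sup K) - F (Inf K))) \<le> e / 2"
        using e' by linarith
      have "norm (\<Sum>(x,K)\<in>q. measure lborel K *\<^sub>R g x - (F (Sup K) - F (Inf K)))
          \<le> (\<Sum>(x,K)\<in>q. norm (F (Sup K) - F (Inf K)))"
        by (rule sum_norm_le) (auto simp: q_def g_def norm_minus_commute)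
      with small_q 1 split show "norm ((\<Sum>(x,K)\<in>p. measure lborel K *\<^sub>R g x) - (F b - F a)) < e"
        by linarith
    qed
  qed
  then show ?thesis
    using has_integral_spike[OF N, of "{a..b}" f g] by (auto simp: g_def)
qed

lemma AE_lebesgue_on_interval_iff:
  fixes a b :: real
  shows "(AE x in lebesgue_on {a..b}. P x) \<longleftrightarrow> (\<exists>N. negligible N \<and> (\<forall>x\<in>{a..b} - N. P x))"
proof -
  have "(AE x in lebesgue_on {a..b}. P x) \<longleftrightarrow> (AE x in lebesgue. x \<in> {a..b} \<longrightarrow> P x)"
    by (rule AE_restrict_space_iff) auto
  also have "\<dots> \<longleftrightarrow> (\<exists>N\<in>null_sets lebesgue. {x. \<not> (x \<in> {a..b} \<longrightarrow> P x)} \<subseteq> N)"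
    by (simp add: eventually_ae_filter)
  also have "\<dots> \<longleftrightarrow> (\<exists>N. negligible N \<and> (\<forall>x\<in>{a..b} - N. P x))"
    unfolding Bex_def negligible_iff_null_sets by blast
  finally show ?thesis .
qed

lemma abs_continuous_on_integral_derivative:
  assumes "a \<le> b" "abs_continuous_on {a..b} F"
    and deriv: "AE x in lebesgue_on {a..b}. (F has_vector_derivative f x) (at x within {a..b})"
    and "integrable (lebesgue_on {a..b}) f"
  shows "(LINT x|lebesgue_on {a..b}. f x) = F b - F a"
proof -
  obtain N where "negligible N"
    "\<forall>x\<in>{a..b} - N. (F has_vector_derivative f x) (at x within {a..b})"
    using deriv unfolding AE_lebesgue_on_interval_iff by blast
  then have "(f has_integral F b - F a) {a..b}"
    using abs_continuous_on_fundamental_theorem assms(1,2) by blast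
  moreover have "(f has_integral (LINT x|lebesgue_on {a..b}. f x)) {a..b}"
    by (rule has_integral_integral_lebesgue_on[OF assms(4)]) simp
  ultimately show ?thesis
    by (metis has_integral_unique)
qed

text \<open>
  This is what makes the Sobolev norm definite: an absolutely continuous function cannot grow on
  a null set.
\<close>
lemma abs_continuous_on_constant:
  assumes AC: "abs_continuous_on {a..b} F"
    and deriv: "AE x in lebesgue_on {a..b}. (F has_vector_derivative 0) (at x within {a..b})"
    and x: "x \<in> {a..b}"
  shows "F x = F a"
proof -
  obtain N where "negligible N"
    and N: "\<forall>t\<in>{a..b} - N. (F has_vector_derivative 0) (at t within {a..b})"
    using deriv unfolding AE_lebesgue_on_interval_iff by blast
  have "((\<lambda>_. 0) has_integral F x - F a) {a..x}"
  proof (rule abs_continuous_on_fundamental_theorem[OF _ _ \<open>negligible N\<close>])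
    show "abs_continuous_on {a..x} F"
      using abs_continuous_on_subset[OF AC] x by simp
    show "(F has_vector_derivative 0) (at t within {a..x})" if "t \<in> {a..x} - N" for t
    proof (rule has_vector_derivative_within_subset)
      show "(F has_vector_derivative 0) (at t within {a..b})"
        using that x by (intro N[rule_format]) auto
    qed (use x in auto)
  qed (use x in simp)
  then have "F x - F a = 0"
    by (metis has_integral_0 has_integral_unique)
  then show ?thesis by simp
qed

lemma abs_continuous_on_integration_by_parts:
  assumes "a \<le> b" and F: "abs_continuous_on {a..b} F" and G: "abs_continuous_on {a..b} G"
    and "AE x in lebesgue_on {a..b}. (F has_vector_derivative f x) (at x within {a..b})"
    and "AE x in lebesgue_on {a..b}. (G has_vector_derivative g x) (at x within {a..b})"
    and fG: "integrable (lebesgue_on {a..b}) (\<lambda>x. f x * G x)"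
    and Fg: "integrable (lebesgue_on {a..b}) (\<lambda>x. F x * g x)"
  shows "(LINT x|lebesgue_on {a..b}. f x * G x) + (LINT x|lebesgue_on {a..b}. F x * g x)
    = F b * G b - F a * G a"
proof -
  have "(LINT x|lebesgue_on {a..b}. F x * g x + f x * G x) = F b * G b - F a * G a"
  proof (rule abs_continuous_on_integral_derivative[OF \<open>a \<le> b\<close> abs_continuous_on_mult[OF F G]])
    show "AE x in lebesgue_on {a..b}.
        ((\<lambda>x. F x * G x) has_vector_derivative F x * g x + f x * G x) (at x within {a..b})"
      using assms(4,5) by eventually_elim (rule has_vector_derivative_mult)
  qed (use fG Fg in simp)
  then show ?thesis
    using fG Fg by (simp add: add.commute)
qed

section \<open>Square integrable functions\<close>

lemma L2_measurable [measurable_dest]: "f \<in> L2 \<Longrightarrow> f \<in> borel_measurable unit_measure"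
  and L2_integrable_norm_square: "f \<in> L2 \<Longrightarrow> integrable unit_measure (\<lambda>x. (norm (f x))\<^sup>2)"
  by (auto simp: L2_def)

lemma L2_mult_integrable:
  assumes f: "f \<in> L2" and g: "g \<in> L2"
  shows "integrable unit_measure (\<lambda>x. f x * g x)"
proof (rule Bochner_Integration.integrable_bound)
  show "integrable unit_measure (\<lambda>x. (norm (f x))\<^sup>2 + (norm (g x))\<^sup>2)"
    using f g by (simp add: L2_integrable_norm_square)
  have "u * v \<le> u\<^sup>2 + v\<^sup>2" if "u \<ge> 0" "v \<ge> 0" for u v :: real
  proof -
    have "2 * u * v \<le> u\<^sup>2 + v\<^sup>2"
      by (rule sum_squares_bound)
    moreover have "u * v \<ge> 0"
      using that by simp
    ultimately show ?thesis
      by linarith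
  qed
  then show "AE x in unit_measure. norm (f x * g x) \<le> norm ((norm (f x))\<^sup>2 + (norm (g x))\<^sup>2)"
    by (simp add: norm_mult)
qed (use f g in \<open>simp add: L2_measurable\<close>)

lemma L2_continuous:
  assumes "continuous_on unit_interval f"
  shows "f \<in> L2"
  using assms unfolding L2_def
  by (auto intro!: continuous_imp_measurable_on_sets_lebesgue continuous_imp_integrable_real
      continuous_intros)

lemma L2_integrable:
  assumes "f \<in> L2"
  shows "integrable unit_measure f"
  using L2_mult_integrable[OF assms L2_continuous[OF continuous_on_const[of _ 1]]] by simp

lemma L2_cnj:
  assumes "f \<in> L2"
  shows "(\<lambda>x. cnj (f x)) \<in> L2"
proof -
  have "(\<lambda>x. cnj (f x)) \<in> borel_measurable unit_measure"
    using borel_measurable_integrable[OF integrable_cnj[OF L2_integrable[OF assms]]] .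
  then show ?thesis
    using assms by (simp add: L2_def)
qed

lemma L2_add_scaled:
  assumes f: "f \<in> L2" and g: "g \<in> L2"
  shows "(\<lambda>x. f x + c * g x) \<in> L2"
proof -
  have m: "(\<lambda>x. f x + c * g x) \<in> borel_measurable unit_measure"
    using f g by (simp add: L2_measurable)
  have "integrable unit_measure (\<lambda>x. (norm (f x + c * g x))\<^sup>2)"
  proof (rule Bochner_Integration.integrable_bound)
    show "integrable unit_measure (\<lambda>x. 2 * (norm (f x))\<^sup>2 + 2 * (norm c)\<^sup>2 * (norm (g x))\<^sup>2)"
      using f g by (simp add: L2_integrable_norm_square)
    have "(norm (u + c * v))\<^sup>2 \<le> 2 * (norm u)\<^sup>2 + 2 * (norm c)\<^sup>2 * (norm v)\<^sup>2" for u v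
    proof -
      have "(norm (u + c * v))\<^sup>2 \<le> (norm u + norm (c * v))\<^sup>2"
        by (intro power_mono norm_triangle_ineq) simp
      also have "\<dots> \<le> 2 * (norm u)\<^sup>2 + 2 * (norm (c * v))\<^sup>2"
        using sum_squares_bound[of "norm u" "norm (c * v)"] by (simp add: power2_sum)
      finally show ?thesis
        by (simp add: norm_mult power_mult_distrib)
    qed
    then show "AE x in unit_measure. norm ((norm (f x + c * g x))\<^sup>2)
        \<le> norm (2 * (norm (f x))\<^sup>2 + 2 * (norm c)\<^sup>2 * (norm (g x))\<^sup>2)"
      by simp
  qed (use m in measurable)
  with m show ?thesis
    by (simp add: L2_def)
qed

text \<open>
  Measurability survives a change on a null set because Lebesgue measure is complete. This matters
  for derivatives of top order, for which linearity holds only almost everywhere.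
\<close>
lemma L2_cong_AE:
  assumes f: "f \<in> L2" and eq: "AE x in unit_measure. f x = g x"
  shows "g \<in> L2"
proof -
  obtain N where N: "negligible N" "\<forall>x\<in>unit_interval - N. f x = g x"
    using eq unfolding AE_lebesgue_on_interval_iff by blast
  have "f measurable_on unit_interval"
    using L2_measurable[OF f] by (simp add: measurable_on_iff_borel_measurable)
  then have "g measurable_on unit_interval"
    by (rule measurable_on_spike[OF _ N(1)]) (use N(2) in auto)
  then have g: "g \<in> borel_measurable unit_measure"
    by (simp add: measurable_on_iff_borel_measurable)
  have "integrable unit_measure (\<lambda>x. (norm (g x))\<^sup>2)"
  proof (rule integrable_cong_AE_imp[OF L2_integrable_norm_square[OF f]])
    show "AE x in unit_measure. (norm (f x))\<^sup>2 = (norm (g x))\<^sup>2"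
      using eq by eventually_elim simp
  qed (use g in measurable)
  with g show ?thesis
    by (simp add: L2_def)
qed

section \<open>Sobolev spaces\<close>

text \<open>
  Iterated derivatives are computed by exhibiting the whole sequence \<open>F\<close> of candidates.
\<close>
lemma nderiv_eqI:
  assumes "\<And>x. x \<in> unit_interval \<Longrightarrow> f x = F 0 x"
    and "\<And>i x. \<lbrakk>i < n; x \<in> unit_interval\<rbrakk>
      \<Longrightarrow> (F i has_vector_derivative F (Suc i) x) (at x within unit_interval)"
    and "x \<in> unit_interval"
  shows "nderiv n f x = F n x"
  using assms(2,3)
proof (induction n arbitrary: x)
  case 0
  then show ?case
    using assms(1) by simp
next
  case (Suc n)
  then have "(nderiv n f has_vector_derivative F (Suc n) x) (at x within unit_interval)"
    by (intro has_vector_derivative_transform[of x unit_interval "nderiv n f" "F n"]) auto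
  then show ?case
    using Suc.prems(2) by (simp add: vector_derivative_within_closed_interval)
qed

lemma vector_derivative_within_cong:
  assumes "x \<in> S" "\<And>y. y \<in> S \<Longrightarrow> f y = g y"
  shows "vector_derivative f (at x within S) = vector_derivative g (at x within S)"
proof -
  have "(f has_vector_derivative f') (at x within S) \<longleftrightarrow> (g has_vector_derivative f') (at x within S)" for f'
    using assms by (metis has_vector_derivative_transform)
  then show ?thesis
    by (simp add: vector_derivative_def)
qed

lemma nderiv_cong:
  assumes "\<And>x. x \<in> unit_interval \<Longrightarrow> f x = g x" "x \<in> unit_interval"
  shows "nderiv n f x = nderiv n g x"
  using assms(2)
proof (induction n arbitrary: x)
  case (Suc n)
  then show ?case
    using vector_derivative_within_cong[of x unit_interval "nderiv n f" "nderiv n g"] by simp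
qed (use assms in simp)

context
  fixes s :: nat and f :: "real \<Rightarrow> complex"
  assumes f: "f \<in> sobolev s"
begin

lemma sobolev_has_vector_derivative:
  assumes "j < s - 1" "x \<in> unit_interval"
  shows "(nderiv j f has_vector_derivative nderiv (Suc j) f x) (at x within unit_interval)"
  using f assms by (simp add: sobolev_def vector_derivative_works)

lemma sobolev_has_vector_derivative_AE:
  assumes "j < s"
  shows "AE x in unit_measure. (nderiv j f has_vector_derivative nderiv (Suc j) f x)
    (at x within unit_interval)"
proof (cases "j = s - 1")
  case True
  have "AE x in unit_measure. nderiv (s - 1) f differentiable (at x within unit_interval)"
    using f by (simp add: sobolev_def)
  then show ?thesis
    unfolding True by eventually_elim (simp add: vector_derivative_works)
next
  case False
  with assms have "j < s - 1"
    by simp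
  then show ?thesis
    using sobolev_has_vector_derivative by (intro AE_I2) simp
qed

text \<open>
  Absolute continuity is part of the definition only for the derivative of order \<open>s - 1\<close>. The lower
  ones have a continuous derivative on a compact interval, hence are Lipschitz. So all
  derivatives of order below \<open>s\<close> obey the fundamental theorem in the same form.
\<close>
lemma sobolev_abs_continuous_on:
  assumes "j < s"
  shows "abs_continuous_on unit_interval (nderiv j f)"
proof -
  have top: "abs_continuous_on unit_interval (nderiv (s - 1) f)"
    using f by (simp add: sobolev_def)
  have cont: "continuous_on unit_interval (nderiv i f)" if "i < s" for i
  proof (cases "i = s - 1")
    case True
    then show ?thesis
      using abs_continuous_on_imp_continuous_on[OF top] by simp
  next
    case False
    with that have "i < s - 1"
      by simp
    then show ?thesis
      using continuous_on_vector_derivative[OF sobolev_has_vector_derivative] by blast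
  qed
  show ?thesis
  proof (cases "j = s - 1")
    case False
    with assms have "j < s - 1"
      by simp
    then show ?thesis
      using abs_continuous_on_C1[OF sobolev_has_vector_derivative cont] by simp
  qed (use top in simp)
qed

lemma sobolev_nderiv_L2:
  assumes "j \<le> s"
  shows "nderiv j f \<in> L2"
proof (cases "j = s")
  case True
  then show ?thesis
    using f by (simp add: sobolev_def)
next
  case False
  with assms show ?thesis
    by (intro L2_continuous abs_continuous_on_imp_continuous_on sobolev_abs_continuous_on) simp
qed

end

lemma nderiv_add_scaled:
  assumes f: "f \<in> sobolev s" and g: "g \<in> sobolev s" and "j < s" "x \<in> unit_interval"
  shows "nderiv j (\<lambda>x. f x + c * g x) x = nderiv j f x + c * nderiv j g x"
  using assms(4)
proof (rule nderiv_eqI[where F = "\<lambda>j x. nderiv j f x + c * nderiv j g x", rotated 2])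
  fix i x assume "i < j" and x: "x \<in> unit_interval"
  then have "i < s - 1"
    using \<open>j < s\<close> by simp
  then show "((\<lambda>x. nderiv i f x + c * nderiv i g x) has_vector_derivative
      nderiv (Suc i) f x + c * nderiv (Suc i) g x) (at x within unit_interval)"
    by (intro has_vector_derivative_add has_vector_derivative_mult_right
        sobolev_has_vector_derivative[OF f] sobolev_has_vector_derivative[OF g] x)
qed simp

text \<open>
  The derivative of order \<open>s - 1\<close> of the sum is known on the whole interval, but its derivative only
  where both summands are differentiable.
\<close>
lemma nderiv_add_scaled_AE:
  assumes f: "f \<in> sobolev s" and g: "g \<in> sobolev s" and "j < s"
  shows "AE x in unit_measure. (nderiv j (\<lambda>x. f x + c * g x) has_vector_derivative
    nderiv (Suc j) f x + c * nderiv (Suc j) g x) (at x within unit_interval)"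
  using sobolev_has_vector_derivative_AE[OF f \<open>j < s\<close>] sobolev_has_vector_derivative_AE[OF g \<open>j < s\<close>]
    AE_space
proof eventually_elim
  case (elim x)
  then have "((\<lambda>x. nderiv j f x + c * nderiv j g x) has_vector_derivative
      nderiv (Suc j) f x + c * nderiv (Suc j) g x) (at x within unit_interval)"
    by (intro has_vector_derivative_add has_vector_derivative_mult_right)
  moreover have "x \<in> unit_interval"
    using elim(3) by simp
  ultimately show ?case
    by (intro has_vector_derivative_transform[OF _ nderiv_add_scaled[OF f g \<open>j < s\<close>]])
qed

lemma nderiv_top_add_scaled_AE:
  assumes "f \<in> sobolev s" "g \<in> sobolev s" "s \<ge> 1"
  shows "AE x in unit_measure. nderiv s (\<lambda>x. f x + c * g x) x = nderiv s f x + c * nderiv s g x"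
proof -
  obtain j where s: "s = Suc j"
    using \<open>s \<ge> 1\<close> by (cases s) auto
  have "AE x in unit_measure. (nderiv j (\<lambda>x. f x + c * g x) has_vector_derivative
      nderiv s f x + c * nderiv s g x) (at x within unit_interval)"
    unfolding s using assms s by (intro nderiv_add_scaled_AE) auto
  then show ?thesis
    using AE_space
  proof eventually_elim
    case (elim x)
    then have "vector_derivative (nderiv j (\<lambda>x. f x + c * g x)) (at x within unit_interval)
        = nderiv s f x + c * nderiv s g x"
      by (intro vector_derivative_within_closed_interval) simp_all
    then show ?case
      unfolding s by simp
  qed
qed

lemma abs_continuous_on_cong:
  assumes "abs_continuous_on S F" "\<And>x. x \<in> S \<Longrightarrow> F x = G x"
  shows "abs_continuous_on S G"
  by (rule abs_continuous_on_dominated[OF assms(1,1), of 1]) (use assms(2) in auto)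

lemma sobolev_add_scaled:
  assumes f: "f \<in> sobolev s" and g: "g \<in> sobolev s" and "s \<ge> 1"
  shows "(\<lambda>x. f x + c * g x) \<in> sobolev s"
proof -
  let ?h = "\<lambda>x. f x + c * g x"
  have "nderiv j ?h differentiable (at x within unit_interval)" if "j < s - 1" "x \<in> unit_interval" for j x
  proof (rule differentiable_transform_within[OF _ zero_less_one that(2)])
    show "(\<lambda>x. nderiv j f x + c * nderiv j g x) differentiable (at x within unit_interval)"
      using f g that by (auto simp: sobolev_def)
    show "nderiv j f y + c * nderiv j g y = nderiv j ?h y" if "y \<in> unit_interval" for y
      using nderiv_add_scaled[OF f g _ that] \<open>j < s - 1\<close> by simp
  qed
  moreover have "abs_continuous_on unit_interval (nderiv (s - 1) ?h)"
  proof (rule abs_continuous_on_cong)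
    show "abs_continuous_on unit_interval (\<lambda>x. nderiv (s - 1) f x + c * nderiv (s - 1) g x)"
      using \<open>s \<ge> 1\<close> by (intro abs_continuous_on_add_scaled sobolev_abs_continuous_on[OF f]
          sobolev_abs_continuous_on[OF g]) simp_all
    show "nderiv (s - 1) f x + c * nderiv (s - 1) g x = nderiv (s - 1) ?h x"
      if "x \<in> unit_interval" for x
      using nderiv_add_scaled[OF f g _ that] \<open>s \<ge> 1\<close> by simp
  qed
  moreover have "AE x in unit_measure.
      (nderiv (s - 1) ?h has_vector_derivative
        nderiv (Suc (s - 1)) f x + c * nderiv (Suc (s - 1)) g x) (at x within unit_interval)"
    using \<open>s \<ge> 1\<close> by (intro nderiv_add_scaled_AE[OF f g]) simp
  then have "AE x in unit_measure. nderiv (s - 1) ?h differentiable (at x within unit_interval)"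
    by eventually_elim (rule differentiableI_vector)
  moreover have "nderiv s ?h \<in> L2"
  proof (rule L2_cong_AE)
    show "(\<lambda>x. nderiv s f x + c * nderiv s g x) \<in> L2"
      by (intro L2_add_scaled sobolev_nderiv_L2[OF f] sobolev_nderiv_L2[OF g]) simp_all
    show "AE x in unit_measure. nderiv s f x + c * nderiv s g x = nderiv s ?h x"
      using nderiv_top_add_scaled_AE[OF assms, of c] by eventually_elim simp
  qed
  ultimately show ?thesis
    by (simp add: sobolev_def)
qed

lemma smooth_imp_sobolev:
  assumes "\<And>i x. \<lbrakk>i \<le> s; x \<in> unit_interval\<rbrakk>
      \<Longrightarrow> (F i has_vector_derivative F (Suc i) x) (at x within unit_interval)"
    and "\<And>x. x \<in> unit_interval \<Longrightarrow> f x = F 0 x" and "s \<ge> 1"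
  shows "f \<in> sobolev s"
proof -
  have eq: "nderiv i f x = F i x" if "i \<le> s" "x \<in> unit_interval" for i x
    by (rule nderiv_eqI[of f F]) (use that assms in auto)
  have deriv: "(nderiv i f has_vector_derivative F (Suc i) x) (at x within unit_interval)"
    if "i \<le> s" "x \<in> unit_interval" for i x
    by (rule has_vector_derivative_transform[OF that(2) eq assms(1)]) (use that in auto)
  have cont: "continuous_on unit_interval (nderiv i f)" if "i \<le> s" for i
    by (rule continuous_on_vector_derivative[OF deriv[OF that]])
  have diff: "nderiv i f differentiable (at x within unit_interval)"
    if "i \<le> s" "x \<in> unit_interval" for i x
    using deriv[OF that] by (rule differentiableI_vector)
  have "abs_continuous_on unit_interval (nderiv (s - 1) f)"
  proof (rule abs_continuous_on_C1)
    show "(nderiv (s - 1) f has_vector_derivative nderiv s f x) (at x within unit_interval)"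
      if "x \<in> unit_interval" for x
      using deriv[of "s - 1" x] eq[of s x] that \<open>s \<ge> 1\<close> by simp
  qed (use cont in simp)
  moreover have "AE x in unit_measure. nderiv (s - 1) f differentiable (at x within unit_interval)"
    using diff by (intro AE_I2) simp
  ultimately show ?thesis
    using diff L2_continuous[OF cont[of s]] by (simp add: sobolev_def)
qed

lemma sobolev_cong:
  assumes "f \<in> sobolev s" "\<And>x. x \<in> unit_interval \<Longrightarrow> f x = g x"
  shows "g \<in> sobolev s"
proof -
  have eq: "nderiv j f x = nderiv j g x" if "x \<in> unit_interval" for j x
    using nderiv_cong assms(2) that by blast
  have diff: "nderiv j g differentiable (at x within unit_interval)"
    if "nderiv j f differentiable (at x within unit_interval)" "x \<in> unit_interval" for j x
    using differentiable_transform_within[OF that(1) zero_less_one that(2)] eq by blast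
  show ?thesis
    unfolding sobolev_def
  proof (intro CollectI conjI allI ballI impI)
    show "nderiv j g differentiable (at x within unit_interval)"
      if "j < s - 1" "x \<in> unit_interval" for j x
      using that assms(1) diff by (simp add: sobolev_def)
    show "abs_continuous_on unit_interval (nderiv (s - 1) g)"
      using assms(1) eq by (auto simp: sobolev_def intro: abs_continuous_on_cong)
    have "AE x in unit_measure. nderiv (s - 1) f differentiable (at x within unit_interval)"
      using assms(1) by (simp add: sobolev_def)
    then show "AE x in unit_measure. nderiv (s - 1) g differentiable (at x within unit_interval)"
      using AE_space by eventually_elim (use diff in auto)
    show "nderiv s g \<in> L2"
    proof (rule L2_cong_AE)
      show "nderiv s f \<in> L2"
        using assms(1) by (simp add: sobolev_def)
      show "AE x in unit_measure. nderiv s f x = nderiv s g x"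
        by (rule AE_I2) (simp add: eq)
    qed
  qed
qed

lemma sobolev_inner_cong:
  assumes "\<And>x. x \<in> unit_interval \<Longrightarrow> f x = f' x" "\<And>x. x \<in> unit_interval \<Longrightarrow> g x = g' x"
  shows "sobolev_inner s f g = sobolev_inner s f' g'"
proof -
  have f: "nderiv l f x = nderiv l f' x" if "x \<in> unit_interval" for l x
    using nderiv_cong assms(1) that by blast
  have g: "nderiv l g x = nderiv l g' x" if "x \<in> unit_interval" for l x
    using nderiv_cong assms(2) that by blast
  have "(LINT x|unit_measure. nderiv l f x) = (LINT x|unit_measure. nderiv l f' x)"
    "(LINT x|unit_measure. cnj (nderiv l g x)) = (LINT x|unit_measure. cnj (nderiv l g' x))"
    "(LINT x|unit_measure. nderiv l f x * cnj (nderiv l g x))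
      = (LINT x|unit_measure. nderiv l f' x * cnj (nderiv l g' x))" for l
    by (rule Bochner_Integration.integral_cong[OF refl]; simp add: f g)+
  then show ?thesis
    unfolding sobolev_inner_def by (simp only:)
qed

section \<open>The Sobolev inner product\<close>

lemma sobolev_inner_cnj: "sobolev_inner s g f = cnj (sobolev_inner s f g)"
proof -
  have "(LINT x|unit_measure. nderiv s g x * cnj (nderiv s f x))
      = cnj (LINT x|unit_measure. nderiv s f x * cnj (nderiv s g x))"
    by (subst Bochner_Integration.integral_cnj[symmetric]) (simp add: mult.commute)
  then show ?thesis
    by (simp add: sobolev_inner_def mult.commute)
qed

lemma sobolev_inner_self:
  "sobolev_inner s f f = of_real ((\<Sum>l<s. (norm (LINT x|unit_measure. nderiv l f x))\<^sup>2)
    + (LINT x|unit_measure. (norm (nderiv s f x))\<^sup>2))"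
  unfolding sobolev_inner_def Bochner_Integration.integral_cnj complex_norm_square[symmetric]
  by (simp only: integral_complex_of_real of_real_add of_real_sum)

lemma sobolev_norm_square:
  "(sobolev_norm s f)\<^sup>2 = (\<Sum>l<s. (norm (LINT x|unit_measure. nderiv l f x))\<^sup>2)
    + (LINT x|unit_measure. (norm (nderiv s f x))\<^sup>2)"
  by (simp add: sobolev_norm_def sobolev_inner_self sum_nonneg)

lemma sobolev_norm_nonneg: "sobolev_norm s f \<ge> 0"
  by (simp add: sobolev_norm_def sobolev_inner_self sum_nonneg)

lemma sobolev_inner_eq_norm_square: "sobolev_inner s f f = of_real ((sobolev_norm s f)\<^sup>2)"
  by (simp only: sobolev_inner_self sobolev_norm_square)

lemma sobolev_inner_add_scaled_left:
  assumes f: "f \<in> sobolev s" and g: "g \<in> sobolev s" and h: "h \<in> sobolev s" and "s \<ge> 1"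
  shows "sobolev_inner s (\<lambda>x. f x + c * g x) h = sobolev_inner s f h + c * sobolev_inner s g h"
proof -
  let ?u = "\<lambda>x. f x + c * g x"
  have u: "?u \<in> sobolev s"
    using sobolev_add_scaled assms by blast
  have lower: "(LINT x|unit_measure. nderiv l ?u x)
      = (LINT x|unit_measure. nderiv l f x) + c * (LINT x|unit_measure. nderiv l g x)" if "l < s" for l
  proof -
    have "(LINT x|unit_measure. nderiv l ?u x)
        = (LINT x|unit_measure. nderiv l f x + c * nderiv l g x)"
      using nderiv_add_scaled[OF f g that] by (intro Bochner_Integration.integral_cong) auto
    then show ?thesis
      using that f g by (simp add: L2_integrable sobolev_nderiv_L2)
  qed
  have int: "integrable unit_measure (\<lambda>x. nderiv s k x * cnj (nderiv s h x))" if "k \<in> sobolev s" for k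
    using that h by (intro L2_mult_integrable L2_cnj sobolev_nderiv_L2) auto
  have "(LINT x|unit_measure. nderiv s ?u x * cnj (nderiv s h x))
      = (LINT x|unit_measure. nderiv s f x * cnj (nderiv s h x) + c * (nderiv s g x * cnj (nderiv s h x)))"
  proof (rule integral_cong_AE)
    show "AE x in unit_measure. nderiv s ?u x * cnj (nderiv s h x)
        = nderiv s f x * cnj (nderiv s h x) + c * (nderiv s g x * cnj (nderiv s h x))"
      using nderiv_top_add_scaled_AE[OF f g \<open>s \<ge> 1\<close>, of c]
      by eventually_elim (simp add: algebra_simps)
  qed (use int f g u in auto)
  also have "\<dots> = (LINT x|unit_measure. nderiv s f x * cnj (nderiv s h x))
      + c * (LINT x|unit_measure. nderiv s g x * cnj (nderiv s h x))"
    using int f g by simp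
  finally show ?thesis
    by (simp add: sobolev_inner_def lower sum.distrib sum_distrib_left algebra_simps)
qed

lemma sobolev_inner_add_scaled_right:
  assumes "f \<in> sobolev s" "g \<in> sobolev s" "h \<in> sobolev s" "s \<ge> 1"
  shows "sobolev_inner s h (\<lambda>x. f x + c * g x) = sobolev_inner s h f + cnj c * sobolev_inner s h g"
  using sobolev_inner_add_scaled_left[OF assms, of c]
  by (simp add: sobolev_inner_cnj[of s h])

text \<open>
  Downward induction on the order: if the derivative of order \<open>j + 1\<close> vanishes almost everywhere, then
  the one of order \<open>j\<close> is constant, and it is zero because its mean is a term of the norm.
\<close>
lemma sobolev_norm_eq_0D:
  assumes f: "f \<in> sobolev s" and "s \<ge> 1" and "sobolev_norm s f = 0" and "x \<in> unit_interval"
  shows "f x = 0"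
proof -
  have nonneg: "(\<Sum>l<s. (norm (LINT x|unit_measure. nderiv l f x))\<^sup>2) \<ge> 0"
    "(LINT x|unit_measure. (norm (nderiv s f x))\<^sup>2) \<ge> 0"
    by (auto intro: sum_nonneg)
  then have "(\<Sum>l<s. (norm (LINT x|unit_measure. nderiv l f x))\<^sup>2) = 0"
    and top: "(LINT x|unit_measure. (norm (nderiv s f x))\<^sup>2) = 0"
    using assms(3) sobolev_norm_square[of s f] by (simp_all add: add_nonneg_eq_0_iff)
  then have mean: "(LINT x|unit_measure. nderiv l f x) = 0" if "l < s" for l
    using that by (simp add: sum_nonneg_eq_0_iff)
  have step: "nderiv j f x = 0"
    if "j < s" "AE x in unit_measure. nderiv (Suc j) f x = 0" "x \<in> unit_interval" for j x
  proof -
    have "AE x in unit_measure. (nderiv j f has_vector_derivative 0) (at x within unit_interval)"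
      using sobolev_has_vector_derivative_AE[OF f that(1)] that(2) by eventually_elim simp
    then have const: "nderiv j f x = nderiv j f 0" if "x \<in> unit_interval" for x
      using abs_continuous_on_constant[OF sobolev_abs_continuous_on[OF f \<open>j < s\<close>]] that by blast
    have "(LINT x|unit_measure. nderiv j f x) = (LINT x|unit_measure. nderiv j f 0)"
      by (rule Bochner_Integration.integral_cong[OF refl], rule const) simp
    also have "\<dots> = nderiv j f 0"
      by (simp add: measure_restrict_space)
    finally show ?thesis
      using mean[OF \<open>j < s\<close>] const[OF that(3)] by simp
  qed
  have "AE x in unit_measure. nderiv (s - m) f x = 0" if "m \<le> s" for m
    using that
  proof (induction m)
    case 0
    have "AE x in unit_measure. (norm (nderiv s f x))\<^sup>2 = 0"
      using top sobolev_nderiv_L2[OF f, of s] L2_integrable_norm_square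
      by (subst integral_nonneg_eq_0_iff_AE[symmetric]) auto
    then show ?case
      by simp
  next
    case (Suc m)
    then have "Suc (s - Suc m) = s - m" "s - Suc m < s"
      by auto
    then show ?case
      using step[of "s - Suc m"] Suc by (intro AE_I2) simp
  qed
  from this[of "s - 1"] show ?thesis
    using step[of 0 x] \<open>s \<ge> 1\<close> \<open>x \<in> unit_interval\<close> by simp
qed

text \<open>
  The usual argument: subtract from \<open>f\<close> its projection to \<open>g\<close>; what remains has nonnegative squared norm.
\<close>
lemma sobolev_Cauchy_Schwarz:
  assumes f: "f \<in> sobolev s" and g: "g \<in> sobolev s" and "s \<ge> 1" and pos: "sobolev_norm s g > 0"
  shows "norm (sobolev_inner s f g) \<le> sobolev_norm s f * sobolev_norm s g"
proof -
  define N where "N = (sobolev_norm s g)\<^sup>2"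
  have "N > 0"
    using pos by (simp add: N_def)
  define c where "c = - sobolev_inner s f g / of_real N"
  let ?u = "\<lambda>x. f x + c * g x"
  have u: "?u \<in> sobolev s"
    using sobolev_add_scaled assms by blast
  have "sobolev_inner s ?u ?u = sobolev_inner s f f + c * sobolev_inner s g f
      + cnj c * (sobolev_inner s f g + c * sobolev_inner s g g)"
    by (simp only: sobolev_inner_add_scaled_right[OF f g u \<open>s \<ge> 1\<close>]
        sobolev_inner_add_scaled_left[OF f g f \<open>s \<ge> 1\<close>]
        sobolev_inner_add_scaled_left[OF f g g \<open>s \<ge> 1\<close>])
  also have "sobolev_inner s f g + c * sobolev_inner s g g = 0"
    using \<open>N > 0\<close> by (simp add: sobolev_inner_eq_norm_square c_def flip: N_def)
  also have "c * sobolev_inner s g f = - of_real ((norm (sobolev_inner s f g))\<^sup>2 / N)"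
    using complex_norm_square[of "sobolev_inner s f g"]
    by (simp add: c_def sobolev_inner_cnj[of s g f])
  finally have "complex_of_real ((sobolev_norm s ?u)\<^sup>2)
      = of_real ((sobolev_norm s f)\<^sup>2 - (norm (sobolev_inner s f g))\<^sup>2 / N)"
    by (simp add: sobolev_inner_eq_norm_square)
  then have "(sobolev_norm s f)\<^sup>2 - (norm (sobolev_inner s f g))\<^sup>2 / N \<ge> 0"
    by (metis of_real_eq_iff zero_le_power2)
  then have "(norm (sobolev_inner s f g))\<^sup>2 \<le> (sobolev_norm s f * sobolev_norm s g)\<^sup>2"
    using \<open>N > 0\<close> by (simp add: field_simps power_mult_distrib flip: N_def)
  then show ?thesis
    by (rule power2_le_imp_le) (simp add: sobolev_norm_nonneg)
qed

section \<open>Bernoulli polynomials\<close>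

lemma poly_antiderivative:
  fixes p :: "'a::field_char_0 poly"
  obtains q where "pderiv q = p"
proof
  let ?q = "\<Sum>i\<le>degree p. monom (coeff p i / of_nat (Suc i)) (Suc i)"
  have "pderiv ?q = (\<Sum>i\<le>degree p. pderiv (monom (coeff p i / of_nat (Suc i)) (Suc i)))"
    using higher_pderiv_sum[of 1 _ "{..degree p}"] by simp
  also have "\<dots> = (\<Sum>i\<le>degree p. monom (coeff p i) i)"
    by (intro sum.cong refl) (simp add: pderiv_monom del: of_nat_Suc)
  finally show "pderiv ?q = p"
    by (simp add: poly_as_sum_of_monoms)
qed

lemma has_integral_poly_pderiv:
  fixes p :: "real poly"
  assumes "a \<le> b"
  shows "(poly (pderiv p) has_integral poly p b - poly p a) {a..b}"
  using assms
  by (intro fundamental_theorem_of_calculus)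
     (auto simp flip: has_real_derivative_iff_has_vector_derivative intro: poly_DERIV has_field_derivative_at_within)

text \<open>
  An antiderivative of the difference of the two polynomials has period one, so it takes its value at 0
  infinitely often and is constant.
\<close>
lemma poly_unit_integrals_eqI:
  fixes p q :: "real poly"
  assumes p: "\<And>t. (poly p has_integral h t) {t..t + 1}" and q: "\<And>t. (poly q has_integral h t) {t..t + 1}"
  shows "p = q"
proof -
  obtain P where P: "pderiv P = p - q"
    by (rule poly_antiderivative)
  have periodic: "poly P (t + 1) = poly P t" for t
  proof -
    have "(poly (p - q) has_integral h t - h t) {t..t + 1}"
      unfolding poly_diff[abs_def] by (rule has_integral_diff[OF p q])
    moreover have "(poly (p - q) has_integral poly P (t + 1) - poly P t) {t..t + 1}"
      unfolding P[symmetric] by (rule has_integral_poly_pderiv) simp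
    ultimately have "h t - h t = poly P (t + 1) - poly P t"
      by (rule has_integral_unique)
    then show ?thesis by simp
  qed
  have "poly P (of_nat n) = poly P 0" for n
    by (induction n) (use periodic in \<open>simp_all add: add.commute[of 1]\<close>)
  then have "range real_of_nat \<subseteq> {t. poly (P - [:poly P 0:]) t = 0}"
    by auto
  then have "infinite {t. poly (P - [:poly P 0:]) t = 0}"
    using infinite_super range_inj_infinite[OF inj_of_nat] by blast
  then have "P = [:poly P 0:]"
    by (metis poly_roots_finite right_minus_eq)
  then have "pderiv P = 0"
    by (metis pderiv_singleton)
  with P show ?thesis by simp
qed

text \<open>
  Integrate the polynomial of degree \<open>l\<close> and choose the constant of integration such that the new
  polynomial has mean zero on the unit interval. Its integral over \<open>{t..t + 1}\<close> then has the derivative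
  \<open>(l + 1) * t ^ l\<close> and vanishes at 0.
\<close>
lemma bernoulli_poly_exists: "\<exists>p. \<forall>t::real. (poly p has_integral t ^ l) {t..t + 1}"
proof (induction l)
  case 0
  have "(poly 1 has_integral t ^ 0) {t..t + 1}" for t :: real
    using has_integral_const_real[of "1::real" t "t + 1"] by (simp add: poly_1[abs_def])
  then show ?case by blast
next
  case (Suc l)
  then obtain p where "\<forall>t::real. (poly p has_integral t ^ l) {t..t + 1}" ..
  then have p: "(poly p has_integral t ^ l) {t..t + 1}" for t ..
  obtain Q where Q: "pderiv Q = smult (of_nat (Suc l)) p"
    by (rule poly_antiderivative)
  obtain R0 where R0: "pderiv R0 = Q"
    by (rule poly_antiderivative)
  define c where "c = poly R0 1 - poly R0 0"
  \<comment> \<open>The summand shifts the antiderivative \<open>Q\<close> of the previous polynomial by its mean.\<close>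
  define R where "R = R0 - [:0, c:]"
  have R: "pderiv R = Q - [:c:]" "poly R 1 = poly R 0"
    by (simp_all add: R_def R0 pderiv_diff pderiv_pCons c_def)
  have step: "poly Q (t + 1) - poly Q t = of_nat (Suc l) * t ^ l" for t
  proof -
    have "(poly (pderiv Q) has_integral poly Q (t + 1) - poly Q t) {t..t + 1}"
      by (rule has_integral_poly_pderiv) simp
    moreover have "(poly (pderiv Q) has_integral of_nat (Suc l) * t ^ l) {t..t + 1}"
      using has_integral_mult_right[OF p[of t], of "of_nat (Suc l)"] unfolding Q by (simp add: poly_smult[abs_def])
    ultimately show ?thesis
      by (rule has_integral_unique)
  qed
  have "poly R (t + 1) - poly R t = t ^ Suc l" for t
  proof -
    define D where "D = (\<lambda>t. poly R (t + 1) - poly R t - t ^ Suc l)"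
    have "(D has_real_derivative 0) (at t)" for t
    proof -
      have "(D has_real_derivative poly (pderiv R) (t + 1) * 1 - poly (pderiv R) t - of_nat (Suc l) * t ^ l) (at t)"
        unfolding D_def by (rule derivative_eq_intros poly_DERIV DERIV_chain2 | simp)+
      then show ?thesis
        using step[of t] by (simp add: R)
    qed
    then have "D t = D 0"
      by (intro DERIV_isconst_all) blast
    then show ?thesis
      by (simp add: D_def R(2))
  qed
  then have "(poly (pderiv R) has_integral t ^ Suc l) {t..t + 1}" for t
    using has_integral_poly_pderiv[of t "t + 1" R] by simp
  then show ?case by blast
qed

lemma bernoulli_poly_integral: "(poly (bernoulli_poly l) has_integral t ^ l) {t..t + 1}"
proof -
  have "\<exists>!p. \<forall>t::real. (poly p has_integral t ^ l) {t..t + 1}"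
    using bernoulli_poly_exists poly_unit_integrals_eqI[of _ "\<lambda>t. t ^ l"]
    by (intro ex_ex1I) auto
  from theI'[OF this] show ?thesis
    by (simp add: bernoulli_poly_def)
qed

lemma bernoulli_poly_0: "bernoulli_poly 0 = 1"
proof (rule poly_unit_integrals_eqI[OF bernoulli_poly_integral])
  show "(poly 1 has_integral t ^ 0) {t..t + 1}" for t :: real
    using has_integral_const_real[of "1::real" t "t + 1"] by (simp add: poly_1[abs_def])
qed

text \<open>
  Differentiating the defining integral equation shows that both sides have the same integrals over all
  intervals of length one.
\<close>
lemma pderiv_bernoulli_poly: "pderiv (bernoulli_poly (Suc l)) = smult (of_nat (Suc l)) (bernoulli_poly l)"
proof (rule poly_unit_integrals_eqI)
  fix t :: real
  obtain R where R: "pderiv R = bernoulli_poly (Suc l)"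
    by (rule poly_antiderivative)
  have diff: "poly R (u + 1) - poly R u = u ^ Suc l" for u
    using has_integral_unique[OF has_integral_poly_pderiv[of u "u + 1" R, unfolded R] bernoulli_poly_integral]
    by simp
  have "((\<lambda>u. poly R (u + 1) - poly R u) has_real_derivative
      poly (pderiv R) (t + 1) * 1 - poly (pderiv R) t) (at t)"
    by (rule derivative_eq_intros poly_DERIV DERIV_chain2 | simp)+
  moreover have "((\<lambda>u. u ^ Suc l) has_real_derivative of_nat (Suc l) * t ^ l) (at t)"
    by (rule derivative_eq_intros | simp)+
  ultimately have "poly (pderiv R) (t + 1) * 1 - poly (pderiv R) t = of_nat (Suc l) * t ^ l"
    unfolding diff by (rule DERIV_unique)
  then show "(poly (pderiv (bernoulli_poly (Suc l))) has_integral of_nat (Suc l) * t ^ l) {t..t + 1}"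
    using has_integral_poly_pderiv[of t "t + 1" "bernoulli_poly (Suc l)"] by (simp add: R)
  show "(poly (smult (of_nat (Suc l)) (bernoulli_poly l)) has_integral of_nat (Suc l) * t ^ l) {t..t + 1}"
    using has_integral_mult_right[OF bernoulli_poly_integral[of l t], of "of_nat (Suc l)"]
    by (simp add: poly_smult[abs_def])
qed

lemma normalized_bernoulli_0: "normalized_bernoulli 0 x = 1"
  by (simp add: normalized_bernoulli_def bernoulli_poly_0)

lemma normalized_bernoulli_deriv:
  "(normalized_bernoulli (Suc l) has_real_derivative normalized_bernoulli l x) (at x within S)"
proof -
  have "((\<lambda>x. poly (bernoulli_poly (Suc l)) x / fact (Suc l)) has_real_derivative
      poly (pderiv (bernoulli_poly (Suc l))) x / fact (Suc l)) (at x within S)"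
    by (rule DERIV_cdivide[OF has_field_derivative_at_within[OF poly_DERIV]])
  moreover have "poly (pderiv (bernoulli_poly (Suc l))) x / fact (Suc l) = normalized_bernoulli l x"
    by (simp add: pderiv_bernoulli_poly normalized_bernoulli_def field_simps del: of_nat_Suc)
  ultimately show ?thesis
    by (simp add: normalized_bernoulli_def[abs_def])
qed

lemma continuous_on_normalized_bernoulli [continuous_intros]:
  "continuous_on S (normalized_bernoulli l)"
  unfolding normalized_bernoulli_def[abs_def] by (intro continuous_intros) auto

lemma integral_normalized_bernoulli:
  "(LINT x|unit_measure. normalized_bernoulli l x) = (if l = 0 then 1 else 0)"
proof -
  have "integrable unit_measure (normalized_bernoulli l)"
    by (intro continuous_imp_integrable_real continuous_on_normalized_bernoulli)
  then have "(normalized_bernoulli l has_integral (LINT x|unit_measure. normalized_bernoulli l x)) {0..1}"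
    by (rule has_integral_integral_lebesgue_on) simp
  moreover have "(normalized_bernoulli l has_integral 0 ^ l / fact l) {0..1}"
    using has_integral_divide[OF bernoulli_poly_integral[of l 0], of "fact l"]
    by (simp add: normalized_bernoulli_def[abs_def])
  ultimately have "(LINT x|unit_measure. normalized_bernoulli l x) = 0 ^ l / fact l"
    by (rule has_integral_unique)
  then show ?thesis
    by (cases l) simp_all
qed

section \<open>Representers and the initial error\<close>

lemma representer_iff_eq_on:
  assumes h: "is_representer k s h" and "s \<ge> 1"
  shows "is_representer k s g \<longleftrightarrow> (\<forall>x\<in>unit_interval. g x = h x)"
proof
  assume g: "is_representer k s g"
  let ?d = "\<lambda>x. g x + (- 1) * h x"
  have gh: "g \<in> sobolev s" "h \<in> sobolev s"
    using g h by (auto simp: is_representer_def)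
  then have d: "?d \<in> sobolev s"
    by (rule sobolev_add_scaled[OF _ _ \<open>s \<ge> 1\<close>])
  have "sobolev_inner s ?d ?d = sobolev_inner s ?d g - sobolev_inner s ?d h"
    unfolding sobolev_inner_add_scaled_right[OF gh d \<open>s \<ge> 1\<close>] by simp
  also have "\<dots> = 0"
    using g h d by (simp add: is_representer_def)
  finally have "sobolev_norm s ?d = 0"
    by (simp add: sobolev_inner_eq_norm_square)
  from sobolev_norm_eq_0D[OF d \<open>s \<ge> 1\<close> this] show "\<forall>x\<in>unit_interval. g x = h x"
    by simp
next
  assume eq: "\<forall>x\<in>unit_interval. g x = h x"
  then have "g \<in> sobolev s"
    using h sobolev_cong[of h s g] by (simp add: is_representer_def)
  moreover have "sobolev_inner s f g = sobolev_inner s f h" for f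
    using eq by (intro sobolev_inner_cong) auto
  ultimately show "is_representer k s g"
    using h by (simp add: is_representer_def)
qed

text \<open>
  The Cauchy-Schwarz inequality gives the upper bound, and the normalized representer attains it.
\<close>
lemma initial_error_eq_representer_norm:
  assumes h: "is_representer k s h" and "s \<ge> 1" and pos: "sobolev_norm s h > 0"
  shows "initial_error k s = ereal (sobolev_norm s h)"
  unfolding initial_error_def
proof (rule SUP_eqI)
  have hs: "h \<in> sobolev s" and rep: "\<And>f. f \<in> sobolev s \<Longrightarrow> fourier_coeff k f = sobolev_inner s f h"
    using h by (auto simp: is_representer_def)
  show "ereal (cmod (fourier_coeff k f)) \<le> ereal (sobolev_norm s h)"
    if "f \<in> {f \<in> sobolev s. sobolev_norm s f \<le> 1}" for f
  proof -
    have "cmod (fourier_coeff k f) \<le> sobolev_norm s f * sobolev_norm s h"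
      using that rep sobolev_Cauchy_Schwarz[OF _ hs \<open>s \<ge> 1\<close> pos] by simp
    also have "\<dots> \<le> 1 * sobolev_norm s h"
      using that pos by (intro mult_right_mono) auto
    finally show ?thesis by simp
  qed
  fix y :: ereal
  assume y: "\<And>f. f \<in> {f \<in> sobolev s. sobolev_norm s f \<le> 1} \<Longrightarrow> ereal (cmod (fourier_coeff k f)) \<le> y"
  define N where "N = sobolev_norm s h"
  have "N > 0"
    using pos by (simp add: N_def)
  \<comment> \<open>With this factor \<open>h + c * h\<close> is \<open>h / N\<close>, in the shape to which the linearity lemmas apply.\<close>
  define c where "c = complex_of_real (1 / N - 1)"
  have c: "of_real N + c * of_real N = 1" "cnj c = c"
    using \<open>N > 0\<close> by (simp_all add: c_def field_simps)
  define u where "u = (\<lambda>x. h x + c * h x)"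
  have u: "u \<in> sobolev s"
    unfolding u_def by (rule sobolev_add_scaled[OF hs hs \<open>s \<ge> 1\<close>])
  have "sobolev_inner s h h = of_real N * of_real N"
    by (simp add: sobolev_inner_eq_norm_square power2_eq_square N_def)
  then have "sobolev_inner s u h = of_real N * of_real N + c * (of_real N * of_real N)"
    using sobolev_inner_add_scaled_left[OF hs hs hs \<open>s \<ge> 1\<close>, of c, folded u_def] by simp
  also have "\<dots> = of_real N * (of_real N + c * of_real N)"
    by (simp add: algebra_simps)
  finally have uh: "sobolev_inner s u h = of_real N"
    unfolding c(1) by simp
  have "sobolev_inner s u u = of_real N + c * of_real N"
    using sobolev_inner_add_scaled_right[OF hs hs u \<open>s \<ge> 1\<close>, of c, folded u_def]
    unfolding uh c(2) .
  then have "complex_of_real ((sobolev_norm s u)\<^sup>2) = 1"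
    unfolding c(1) sobolev_inner_eq_norm_square .
  then have "(sobolev_norm s u)\<^sup>2 = 1"
    by (metis of_real_1 of_real_eq_iff)
  then have "sobolev_norm s u \<le> 1"
    by (auto simp: power2_eq_1_iff)
  with u have "ereal (cmod (fourier_coeff k u)) \<le> y"
    by (intro y) simp
  then show "ereal (sobolev_norm s h) \<le> y"
    using rep[OF u] uh \<open>N > 0\<close> by (simp add: N_def)
qed

section \<open>Fourier integrals of Sobolev functions\<close>

lemma has_vector_derivative_exp_linear:
  fixes a :: complex
  shows "((\<lambda>x::real. exp (a * of_real x)) has_vector_derivative a * exp (a * of_real x)) (at x within S)"
proof -
  have "((\<lambda>z. exp (a * z)) has_field_derivative a * exp (a * of_real x)) (at (complex_of_real x))"
    by (rule derivative_eq_intros refl | simp)+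
  then show ?thesis
    by (rule has_vector_derivative_real_field)
qed

lemma continuous_on_exp_linear: "continuous_on S (\<lambda>x::real. exp (a * complex_of_real x))"
  by (intro continuous_intros)

lemma integral_exp_periodic:
  assumes "a \<noteq> 0" "exp a = 1"
  shows "(LINT x|unit_measure. exp (a * complex_of_real x)) = 0"
proof -
  have "integrable unit_measure (\<lambda>x. exp (a * complex_of_real x))"
    by (intro L2_integrable L2_continuous continuous_on_exp_linear)
  moreover have "((\<lambda>x::real. exp (a * of_real x) / a) has_vector_derivative exp (a * of_real x))
      (at x within unit_interval)" for x
    using has_vector_derivative_divide[OF has_vector_derivative_exp_linear[of a x unit_interval], of a]
      \<open>a \<noteq> 0\<close> by simp
  ultimately have "(LINT x|unit_measure. exp (a * complex_of_real x))
      = exp (a * of_real 1) / a - exp (a * of_real 0) / a"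
    by (intro abs_continuous_on_integral_derivative abs_continuous_on_C1[of 0 1 _ "\<lambda>x. exp (a * of_real x)"]
        AE_I2 continuous_on_exp_linear) simp_all
  with \<open>exp a = 1\<close> show ?thesis by simp
qed

text \<open>
  Integration by parts. As the exponential has the value 1 at both endpoints, the boundary term is the
  increment of the derivative of order \<open>j\<close>, that is, the integral of the next one.
\<close>
lemma fourier_integral_step:
  assumes f: "f \<in> sobolev s" and "j < s" and a: "exp a = 1"
  shows "a * (LINT x|unit_measure. nderiv j f x * exp (- a * of_real x))
    = (LINT x|unit_measure. nderiv (Suc j) f x * exp (- a * of_real x))
      - (LINT x|unit_measure. nderiv (Suc j) f x)"
proof -
  let ?e = "\<lambda>x::real. exp (- a * of_real x)"
  have L2: "nderiv j f \<in> L2" "nderiv (Suc j) f \<in> L2" "?e \<in> L2"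
    using sobolev_nderiv_L2[OF f, of j] sobolev_nderiv_L2[OF f, of "Suc j"] \<open>j < s\<close>
      L2_continuous[OF continuous_on_exp_linear[of unit_interval "- a"]] by simp_all
  have AC: "abs_continuous_on unit_interval (nderiv j f)"
    and deriv: "AE x in unit_measure. (nderiv j f has_vector_derivative nderiv (Suc j) f x)
      (at x within unit_interval)"
    using sobolev_abs_continuous_on[OF f \<open>j < s\<close>] sobolev_has_vector_derivative_AE[OF f \<open>j < s\<close>] .
  have e: "abs_continuous_on unit_interval ?e"
    by (rule abs_continuous_on_C1[OF has_vector_derivative_exp_linear])
       (intro continuous_intros)
  have int: "integrable unit_measure (\<lambda>x. nderiv j f x * ?e x)"
    "integrable unit_measure (\<lambda>x. nderiv (Suc j) f x * ?e x)"
    by (rule L2_mult_integrable[OF L2(1,3)], rule L2_mult_integrable[OF L2(2,3)])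
  have "(LINT x|unit_measure. nderiv (Suc j) f x * ?e x) + (LINT x|unit_measure. nderiv j f x * (- a * ?e x))
      = nderiv j f 1 * ?e 1 - nderiv j f 0 * ?e 0"
  proof (rule abs_continuous_on_integration_by_parts[OF _ AC e deriv _ int(2)])
    show "AE x in unit_measure. (?e has_vector_derivative - a * ?e x) (at x within unit_interval)"
      by (intro AE_I2 has_vector_derivative_exp_linear)
    show "integrable unit_measure (\<lambda>x. nderiv j f x * (- a * ?e x))"
      using integrable_mult_right[OF int(1), of "- a"] by (simp add: mult.left_commute)
  qed simp
  also have "\<dots> = nderiv j f 1 - nderiv j f 0"
    using a by (simp add: exp_minus)
  also have "\<dots> = (LINT x|unit_measure. nderiv (Suc j) f x)"
    by (rule abs_continuous_on_integral_derivative[symmetric, OF _ AC deriv L2_integrable[OF L2(2)]]) simp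
  also have "(LINT x|unit_measure. nderiv j f x * (- a * ?e x)) = - a * (LINT x|unit_measure. nderiv j f x * ?e x)"
    by (simp add: mult.left_commute)
  finally show ?thesis
    by (simp add: algebra_simps)
qed

lemma fourier_integral_expansion:
  assumes f: "f \<in> sobolev s" and "m \<le> s" and a: "exp a = 1" "a \<noteq> 0"
  shows "(LINT x|unit_measure. f x * exp (- a * of_real x))
    = (LINT x|unit_measure. nderiv m f x * exp (- a * of_real x)) / a ^ m
      - (\<Sum>l<m. (LINT x|unit_measure. nderiv (Suc l) f x) / a ^ Suc l)"
  using \<open>m \<le> s\<close>
proof (induction m)
  case (Suc m)
  have "(LINT x|unit_measure. nderiv m f x * exp (- a * of_real x))
      = ((LINT x|unit_measure. nderiv (Suc m) f x * exp (- a * of_real x))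
        - (LINT x|unit_measure. nderiv (Suc m) f x)) / a"
    unfolding nonzero_eq_divide_eq[OF \<open>a \<noteq> 0\<close>]
    by (subst mult.commute) (rule fourier_integral_step[OF f _ a(1)], use Suc.prems in simp)
  with Suc show ?case
    by (simp add: diff_divide_distrib)
qed simp

section \<open>The representer built from Bernoulli polynomials\<close>

definition angular_freq :: "int \<Rightarrow> complex"
  where "angular_freq k = 2 * of_real pi * \<i> * of_int k"

lemma exp_angular_freq: "exp (angular_freq k) = 1"
  using exp_integer_2pi[of "of_int k"] by (simp add: angular_freq_def mult_ac)

lemma cnj_angular_freq: "cnj (angular_freq k) = - angular_freq k"
  by (simp add: angular_freq_def)

lemma norm_angular_freq: "norm (angular_freq k) = 2 * pi * \<bar>of_int k\<bar>"
  by (simp add: angular_freq_def norm_mult)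

lemma angular_freq_eq_0_iff: "angular_freq k = 0 \<longleftrightarrow> k = 0"
  by (simp add: angular_freq_def)

lemma fourier_coeff_eq: "fourier_coeff k f = (LINT x|unit_measure. f x * exp (- angular_freq k * of_real x))"
  by (simp add: fourier_coeff_def angular_freq_def)

text \<open>
  The derivative of order \<open>j\<close> of the normalized Bernoulli polynomial of degree \<open>l\<close>.
\<close>
definition bernoulli_deriv :: "nat \<Rightarrow> nat \<Rightarrow> real \<Rightarrow> real"
  where "bernoulli_deriv j l x = (if l < j then 0 else normalized_bernoulli (l - j) x)"

text \<open>
  The derivative of order \<open>j\<close> of the representer; the representer itself is the case \<open>j = 0\<close>. Keeping
  the order as a parameter makes the sequence of all derivatives available at once.
\<close>
definition representer_deriv :: "int \<Rightarrow> nat \<Rightarrow> nat \<Rightarrow> real \<Rightarrow> complex"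
  where "representer_deriv k s j x =
    1 / (2 * of_real pi * of_int k) ^ (2 * s) * (angular_freq k ^ j * exp (angular_freq k * of_real x))
    - (\<Sum>l = 1..s. (- 1) ^ l * (1 / angular_freq k ^ l) * complex_of_real (bernoulli_deriv j l x))"

lemma bernoulli_deriv_has_derivative:
  "(bernoulli_deriv j l has_real_derivative bernoulli_deriv (Suc j) l x) (at x within S)"
proof -
  consider "l < j" | "l = j" | "j < l" by linarith
  then show ?thesis
  proof cases
    case 3
    then have "l - j = Suc (l - Suc j)"
      by simp
    then show ?thesis
      using 3 normalized_bernoulli_deriv[of "l - Suc j"] by (simp add: bernoulli_deriv_def[abs_def])
  qed (simp_all add: bernoulli_deriv_def[abs_def] normalized_bernoulli_0)
qed

lemma integral_bernoulli_deriv: "(LINT x|unit_measure. bernoulli_deriv j l x) = (if l = j then 1 else 0)"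
  by (cases "l < j") (simp_all add: bernoulli_deriv_def integral_normalized_bernoulli)

lemma continuous_on_bernoulli_deriv: "continuous_on S (bernoulli_deriv j l)"
  by (rule DERIV_continuous_on[OF bernoulli_deriv_has_derivative])

lemma representer_deriv_has_vector_derivative:
  "(representer_deriv k s j has_vector_derivative representer_deriv k s (Suc j) x) (at x within S)"
proof -
  have "((\<lambda>x. complex_of_real (bernoulli_deriv j l x)) has_vector_derivative
      of_real (bernoulli_deriv (Suc j) l x)) (at x within S)" for l
    using bernoulli_deriv_has_derivative by (rule has_vector_derivative_of_real)
  then have "(representer_deriv k s j has_vector_derivative
      1 / (2 * of_real pi * of_int k) ^ (2 * s) * (angular_freq k ^ j * (angular_freq k * exp (angular_freq k * of_real x)))
      - (\<Sum>l = 1..s. (- 1) ^ l * (1 / angular_freq k ^ l) * complex_of_real (bernoulli_deriv (Suc j) l x)))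
      (at x within S)"
    unfolding representer_deriv_def[abs_def]
    by (intro has_vector_derivative_diff has_vector_derivative_mult_right has_vector_derivative_sum
        has_vector_derivative_exp_linear)
  then show ?thesis
    by (simp add: representer_deriv_def mult_ac)
qed

lemma nderiv_representer:
  "x \<in> unit_interval \<Longrightarrow> nderiv j (representer_deriv k s 0) x = representer_deriv k s j x"
  by (rule nderiv_eqI[of _ "representer_deriv k s"]) (simp_all add: representer_deriv_has_vector_derivative)

lemma representer_in_sobolev: "s \<ge> 1 \<Longrightarrow> representer_deriv k s 0 \<in> sobolev s"
  by (rule smooth_imp_sobolev[of s "representer_deriv k s"])
     (simp_all add: representer_deriv_has_vector_derivative)

text \<open>
  The exponential has mean zero, and so has every normalized Bernoulli polynomial except the one of
  degree 0. Hence the mean of the derivative of order \<open>j\<close> singles out the coefficient with index \<open>j\<close>.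
\<close>
lemma integral_representer_deriv:
  assumes "k \<noteq> 0" "j \<le> s"
  shows "(LINT x|unit_measure. representer_deriv k s j x)
    = (if j = 0 then 0 else - ((- 1) ^ j / angular_freq k ^ j))"
proof -
  let ?\<omega> = "angular_freq k"
  have e: "integrable unit_measure (\<lambda>x. exp (?\<omega> * complex_of_real x))"
    by (intro L2_integrable L2_continuous continuous_on_exp_linear)
  have b: "integrable unit_measure (\<lambda>x. complex_of_real (bernoulli_deriv j l x))" for l
    by (intro L2_integrable L2_continuous continuous_on_of_real continuous_on_bernoulli_deriv)
  have "(LINT x|unit_measure. representer_deriv k s j x)
      = 1 / (2 * of_real pi * of_int k) ^ (2 * s) * (?\<omega> ^ j * (LINT x|unit_measure. exp (?\<omega> * complex_of_real x)))
        - (\<Sum>l = 1..s. (- 1) ^ l * (1 / ?\<omega> ^ l) * (LINT x|unit_measure. complex_of_real (bernoulli_deriv j l x)))"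
    unfolding representer_deriv_def using e b by simp
  also have "\<dots> = - (\<Sum>l = 1..s. if l = j then (- 1) ^ l * (1 / ?\<omega> ^ l) else 0)"
    using integral_exp_periodic[OF _ exp_angular_freq] \<open>k \<noteq> 0\<close>
    by (simp add: angular_freq_eq_0_iff integral_complex_of_real integral_bernoulli_deriv if_distrib cong: if_cong)
  also have "\<dots> = (if j = 0 then 0 else - ((- 1) ^ j / ?\<omega> ^ j))"
    using \<open>j \<le> s\<close> by (simp add: sum.delta)
  finally show ?thesis .
qed

text \<open>
  In the derivative of order \<open>s\<close> only the exponential and the constant from the Bernoulli polynomial of
  degree \<open>s\<close> are left. The factor of the exponential in the representer is chosen such that both have the same
  coefficient up to sign; this rests on \<open>(2 * pi * k)\<^sup>2 = - (2 * pi * \<i> * k)\<^sup>2\<close>.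
\<close>
lemma representer_deriv_top:
  assumes "k \<noteq> 0" "s \<ge> 1"
  shows "representer_deriv k s s x = (- 1) ^ s / angular_freq k ^ s * (exp (angular_freq k * of_real x) - 1)"
proof -
  let ?\<omega> = "angular_freq k"
  have \<omega>: "?\<omega> \<noteq> 0"
    using \<open>k \<noteq> 0\<close> by (simp add: angular_freq_eq_0_iff)
  have "(2 * of_real pi * of_int k) ^ 2 = - (?\<omega> * ?\<omega>)"
    by (simp add: angular_freq_def power2_eq_square)
  then have "(2 * complex_of_real pi * of_int k) ^ (2 * s) = (- 1) ^ s * (?\<omega> ^ s * ?\<omega> ^ s)"
    unfolding power_mult by (simp add: power_minus[of "?\<omega> * ?\<omega>"] power_mult_distrib)
  then have "1 / (2 * complex_of_real pi * of_int k) ^ (2 * s) * ?\<omega> ^ s = (- 1) ^ s / ?\<omega> ^ s"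
    using \<omega> by (simp add: field_simps flip: power_mult_distrib)
  moreover have "(\<Sum>l = 1..s. (- 1) ^ l * (1 / ?\<omega> ^ l) * complex_of_real (bernoulli_deriv s l x))
      = (\<Sum>l\<in>{s}. (- 1) ^ l * (1 / ?\<omega> ^ l))"
    using \<open>s \<ge> 1\<close>
    by (intro sum.mono_neutral_cong_right) (auto simp: bernoulli_deriv_def normalized_bernoulli_0)
  ultimately show ?thesis
    by (simp add: representer_deriv_def right_diff_distrib flip: mult.assoc)
qed

text \<open>
  By the two preceding lemmas, the inner product of \<open>f\<close> with the representer is term by term the
  expansion of the Fourier coefficient of \<open>f\<close> into integrals of its derivatives. Complex conjugation
  changes the sign of the frequency, which cancels the alternating signs.
\<close>
lemma is_representer_bernoulli:
  assumes "k \<noteq> 0" "s \<ge> 1"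
  shows "is_representer k s (representer_deriv k s 0)"
  unfolding is_representer_def
proof (intro conjI ballI)
  let ?\<omega> = "angular_freq k" and ?h = "representer_deriv k s 0"
  have \<omega>: "?\<omega> \<noteq> 0"
    using \<open>k \<noteq> 0\<close> by (simp add: angular_freq_eq_0_iff)
  show "?h \<in> sobolev s"
    using representer_in_sobolev \<open>s \<ge> 1\<close> .
  fix f assume f: "f \<in> sobolev s"
  obtain n where s: "s = Suc n"
    using \<open>s \<ge> 1\<close> by (cases s) auto
  let ?M = "\<lambda>l. LINT x|unit_measure. nderiv l f x"
  have mean: "(LINT x|unit_measure. cnj (nderiv l ?h x)) = (if l = 0 then 0 else - (1 / ?\<omega> ^ l))"
    if "l < s" for l
  proof -
    have "(LINT x|unit_measure. cnj (nderiv l ?h x)) = (LINT x|unit_measure. cnj (representer_deriv k s l x))"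
      by (rule Bochner_Integration.integral_cong) (simp_all add: nderiv_representer)
    also have "\<dots> = (if l = 0 then 0 else - ((- 1) ^ l / (- ?\<omega>) ^ l))"
      using integral_representer_deriv[OF \<open>k \<noteq> 0\<close>, of l s] that by (simp add: cnj_angular_freq)
    also have "(- 1) ^ l / (- ?\<omega>) ^ l = 1 / ?\<omega> ^ l"
      by (subst power_minus) simp
    finally show ?thesis .
  qed
  have cnj_top: "cnj (representer_deriv k s s x) = (exp (- ?\<omega> * of_real x) - 1) / ?\<omega> ^ s" for x
  proof -
    have "cnj (representer_deriv k s s x) = (- 1) ^ s / (- ?\<omega>) ^ s * (exp (- ?\<omega> * of_real x) - 1)"
      using representer_deriv_top[OF assms, of x] by (simp add: cnj_angular_freq exp_cnj)
    also have "(- 1) ^ s / (- ?\<omega>) ^ s = 1 / ?\<omega> ^ s"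
      by (subst power_minus) simp
    finally show ?thesis by simp
  qed
  have int: "integrable unit_measure (\<lambda>x. nderiv s f x * exp (- ?\<omega> * of_real x))"
    "integrable unit_measure (nderiv s f)"
    using L2_mult_integrable[OF sobolev_nderiv_L2[OF f order_refl] L2_continuous[OF continuous_on_exp_linear]]
      L2_integrable[OF sobolev_nderiv_L2[OF f order_refl]] .
  have "(LINT x|unit_measure. nderiv s f x * cnj (nderiv s ?h x))
      = (LINT x|unit_measure. (nderiv s f x * exp (- ?\<omega> * of_real x) - nderiv s f x) / ?\<omega> ^ s)"
    by (rule Bochner_Integration.integral_cong[OF refl])
       (simp add: nderiv_representer cnj_top algebra_simps)
  also have "\<dots> = ((LINT x|unit_measure. nderiv s f x * exp (- ?\<omega> * of_real x)) - ?M s) / ?\<omega> ^ s"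
    using int by simp
  finally have top: "(LINT x|unit_measure. nderiv s f x * cnj (nderiv s ?h x)) = \<dots>" .
  have "sobolev_inner s f ?h = (\<Sum>l<s. ?M l * (if l = 0 then 0 else - (1 / ?\<omega> ^ l)))
      + ((LINT x|unit_measure. nderiv s f x * exp (- ?\<omega> * of_real x)) - ?M s) / ?\<omega> ^ s"
    unfolding sobolev_inner_def top
    by (intro arg_cong[of _ _ "\<lambda>z. z + _"] sum.cong refl) (simp only: mean lessThan_iff)
  also have "(\<Sum>l<s. ?M l * (if l = 0 then 0 else - (1 / ?\<omega> ^ l))) = - (\<Sum>l<n. ?M (Suc l) / ?\<omega> ^ Suc l)"
    unfolding s sum.lessThan_Suc_shift by (simp add: sum_negf)
  finally show "fourier_coeff k f = sobolev_inner s f ?h"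
    unfolding fourier_coeff_eq fourier_integral_expansion[OF f order_refl exp_angular_freq \<omega>]
    by (simp add: s diff_divide_distrib)
qed

text \<open>
  The mean of order \<open>l\<close> contributes \<open>(2 * pi * k) ^ (- 2 * l)\<close>. The top derivative is a constant
  times \<open>z - 1\<close> with \<open>z\<close> running once or several times around the unit circle, and
  \<open>(norm (z - 1))\<^sup>2 = 2 - 2 * Re z\<close> has the mean 2.
\<close>
lemma representer_norm_square:
  assumes "k \<noteq> 0" "s \<ge> 1"
  shows "(sobolev_norm s (representer_deriv k s 0))\<^sup>2
    = 2 / (2 * pi * of_int k) ^ (2 * s) + (\<Sum>l = 1..s - 1. 1 / (2 * pi * of_int k) ^ (2 * l))"
proof -
  let ?\<omega> = "angular_freq k" and ?c = "2 * pi * real_of_int k"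
  have \<omega>: "?\<omega> \<noteq> 0"
    using \<open>k \<noteq> 0\<close> by (simp add: angular_freq_eq_0_iff)
  obtain n where s: "s = Suc n"
    using \<open>s \<ge> 1\<close> by (cases s) auto
  have pow: "(norm ((- 1) ^ l / ?\<omega> ^ l))\<^sup>2 = 1 / ?c ^ (2 * l)" for l
  proof -
    have "(\<bar>?c\<bar> ^ l)\<^sup>2 = \<bar>?c\<bar> ^ (2 * l)"
      by (simp only: power_mult[symmetric] mult.commute)
    also have "\<dots> = ?c ^ (2 * l)"
      by (rule power_even_abs) simp
    finally have "(norm ?\<omega> ^ l)\<^sup>2 = ?c ^ (2 * l)"
      by (simp add: norm_angular_freq abs_mult)
    then show ?thesis
      by (simp add: norm_divide norm_power power_divide)
  qed
  have mean: "(norm (LINT x|unit_measure. nderiv l (representer_deriv k s 0) x))\<^sup>2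
      = (if l = 0 then 0 else 1 / ?c ^ (2 * l))" if "l < s" for l
  proof -
    have "(LINT x|unit_measure. nderiv l (representer_deriv k s 0) x) = (LINT x|unit_measure. representer_deriv k s l x)"
      by (rule Bochner_Integration.integral_cong) (simp_all add: nderiv_representer)
    then show ?thesis
      using integral_representer_deriv[OF \<open>k \<noteq> 0\<close>, of l s] that pow[of l] by simp
  qed
  have e: "integrable unit_measure (\<lambda>x. exp (?\<omega> * complex_of_real x))"
    by (intro L2_integrable L2_continuous continuous_on_exp_linear)
  have unit: "(norm (exp (?\<omega> * complex_of_real x) - 1))\<^sup>2 = 2 - 2 * Re (exp (?\<omega> * complex_of_real x))" for x
  proof -
    have on_circle: "(norm (z - 1))\<^sup>2 = 2 - 2 * Re z" if "norm z = 1" for z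
    proof -
      have "(Re z)\<^sup>2 + (Im z)\<^sup>2 = 1"
        by (simp add: that flip: cmod_power2)
      then show ?thesis
        unfolding cmod_power2 by (simp add: power2_diff)
    qed
    have "norm (exp (?\<omega> * complex_of_real x)) = 1"
      by (simp add: angular_freq_def)
    then show ?thesis
      by (rule on_circle)
  qed
  have "(LINT x|unit_measure. (norm (nderiv s (representer_deriv k s 0) x))\<^sup>2)
      = (LINT x|unit_measure. 1 / ?c ^ (2 * s) * (2 - 2 * Re (exp (?\<omega> * complex_of_real x))))"
  proof (rule Bochner_Integration.integral_cong[OF refl])
    fix x assume "x \<in> space unit_measure"
    then show "(norm (nderiv s (representer_deriv k s 0) x))\<^sup>2
        = 1 / ?c ^ (2 * s) * (2 - 2 * Re (exp (?\<omega> * complex_of_real x)))"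
      by (simp only: nderiv_representer space_lebesgue_on representer_deriv_top[OF assms]
          norm_mult power_mult_distrib pow unit)
  qed
  also have "\<dots> = 1 / ?c ^ (2 * s) * (2 - 2 * Re (LINT x|unit_measure. exp (?\<omega> * complex_of_real x)))"
    using e by (simp add: measure_restrict_space)
  also have "\<dots> = 2 / ?c ^ (2 * s)"
    using integral_exp_periodic[OF \<omega> exp_angular_freq] by simp
  finally have top: "(LINT x|unit_measure. (norm (nderiv s (representer_deriv k s 0) x))\<^sup>2) = \<dots>" .
  have "(\<Sum>l<s. (norm (LINT x|unit_measure. nderiv l (representer_deriv k s 0) x))\<^sup>2)
      = (\<Sum>l<s. if l = 0 then 0 else 1 / ?c ^ (2 * l))"
    by (intro sum.cong) (auto simp: mean)
  also have "\<dots> = (\<Sum>l = 1..s - 1. 1 / ?c ^ (2 * l))"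
    unfolding s sum.lessThan_Suc_shift by (simp add: sum.atLeast1_atMost_eq)
  finally show ?thesis
    unfolding sobolev_norm_square top by simp
qed

lemma is_representer_const: "s \<ge> 1 \<Longrightarrow> is_representer 0 s (\<lambda>_. 1)"
  and sobolev_norm_const: "s \<ge> 1 \<Longrightarrow> sobolev_norm s (\<lambda>_. 1) = 1"
proof -
  assume "s \<ge> 1"
  define F :: "nat \<Rightarrow> real \<Rightarrow> complex" where "F = (\<lambda>j _. if j = 0 then 1 else 0)"
  have F: "(F i has_vector_derivative F (Suc i) x) (at x within unit_interval)" for i x
    by (simp add: F_def)
  have nd: "nderiv j (\<lambda>_. 1) x = (if j = 0 then 1 else 0)" if "x \<in> unit_interval" for j x
    using nderiv_eqI[of "\<lambda>_. 1" F j x] F that by (simp add: F_def)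
  have mean: "(LINT x|unit_measure. nderiv j (\<lambda>_. 1) x) = (if j = 0 then 1 else 0)" for j
  proof -
    have "(LINT x|unit_measure. nderiv j (\<lambda>_. 1) x) = (LINT x|unit_measure. (if j = 0 then 1 else 0))"
      by (rule Bochner_Integration.integral_cong) (simp_all add: nd)
    then show ?thesis
      by (simp add: measure_restrict_space)
  qed
  have top: "(LINT x|unit_measure. g x * cnj (nderiv s (\<lambda>_. 1) x)) = 0" for g
  proof -
    have "(LINT x|unit_measure. g x * cnj (nderiv s (\<lambda>_. 1) x)) = (LINT x|unit_measure. 0)"
      by (rule Bochner_Integration.integral_cong) (use \<open>s \<ge> 1\<close> in \<open>simp_all add: nd\<close>)
    then show ?thesis by simp
  qed
  have inner: "sobolev_inner s f (\<lambda>_. 1) = (LINT x|unit_measure. f x)" for f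
    unfolding sobolev_inner_def top Bochner_Integration.integral_cnj mean using \<open>s \<ge> 1\<close>
    by (simp add: if_distrib sum.delta cong: if_cong)
  have "(\<lambda>_. 1) \<in> sobolev s"
    by (rule smooth_imp_sobolev[of s F]) (use F \<open>s \<ge> 1\<close> in \<open>simp_all add: F_def\<close>)
  then show "is_representer 0 s (\<lambda>_. 1)"
    by (simp add: is_representer_def inner fourier_coeff_def)
  show "sobolev_norm s (\<lambda>_. 1) = 1"
    unfolding sobolev_norm_def inner by (simp add: measure_restrict_space)
qed

section \<open>The constant in the initial error\<close>

lemma geometric_norm_square:
  fixes q :: real
  assumes "q > 1" "s > 1"
  shows "2 / q ^ s + (\<Sum>l = 1..s - 1. 1 / q ^ l) = (q ^ s + q - 2) / (q ^ s - q ^ (s - 1)) / q"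
proof -
  obtain n where s: "s = Suc n"
    using \<open>s > 1\<close> by (cases s) auto
  have "(q - 1) * (\<Sum>l = 1..m. 1 / q ^ l) = 1 - 1 / q ^ m" for m
    by (induction m) (use \<open>q > 1\<close> in \<open>simp_all add: field_simps\<close>)
  then have geometric: "(\<Sum>l = 1..n. 1 / q ^ l) = (1 - 1 / q ^ n) / (q - 1)"
    using \<open>q > 1\<close> by (metis diff_gt_0_iff_gt less_numeral_extra(3) nonzero_mult_div_cancel_left)
  show ?thesis
    unfolding s diff_Suc_1 geometric using \<open>q > 1\<close> by (simp add: field_simps)
qed

text \<open>
  The numerical bound 1.02566 on the constant leaves little room: it needs the square to exceed 39.4775.
\<close>
lemma four_pi_square_le:
  assumes "k \<noteq> 0"
  shows "39.4783 \<le> (2 * pi * real_of_int k)\<^sup>2"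
proof -
  have "39.4783 \<le> (2 * (3.141592 :: real))\<^sup>2"
    by (simp add: power2_eq_square)
  also have "\<dots> \<le> (2 * pi)\<^sup>2"
    using pi_approx(1) by (intro power_mono mult_left_mono) auto
  finally have "39.4783 \<le> (2 * pi)\<^sup>2" .
  moreover have "\<bar>real_of_int k\<bar> \<ge> 1"
    using assms by linarith
  then have "(2 * pi)\<^sup>2 * 1 \<le> (2 * pi)\<^sup>2 * \<bar>real_of_int k\<bar>\<^sup>2"
    by (intro mult_left_mono one_le_power) auto
  ultimately have "39.4783 \<le> (2 * pi)\<^sup>2 * \<bar>real_of_int k\<bar>\<^sup>2"
    by linarith
  then show ?thesis
    by (simp add: power_mult_distrib)
qed

lemma beta_const_bounds:
  assumes "k \<noteq> 0" "s > 1"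
  shows "1 \<le> beta_const k s" and "beta_const k s \<le> sqrt (1 + 2 / ((2 * pi * of_int k)\<^sup>2 - 1))"
proof -
  define q where "q = (2 * pi * real_of_int k)\<^sup>2"
  have "q > 1"
    using four_pi_square_le[OF \<open>k \<noteq> 0\<close>] by (simp add: q_def)
  obtain n where s: "s = Suc (Suc n)"
    using \<open>s > 1\<close> by (metis Suc_lessE One_nat_def less_imp_Suc_add add_Suc)
  have beta: "beta_const k s = sqrt ((q ^ s + q - 2) / (q ^ s - q ^ (s - 1)))"
    using \<open>s > 1\<close> by (simp add: beta_const_def q_def flip: power_mult)
  have qn: "q ^ n \<ge> 1" "q ^ n > 0"
    using \<open>q > 1\<close> by simp_all
  have "q ^ s - q ^ (s - 1) = q ^ (s - 1) * (q - 1)"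
    by (simp add: s algebra_simps)
  then have pos: "q ^ s - q ^ (s - 1) > 0"
    using \<open>q > 1\<close> by simp
  have "q * q ^ n \<ge> q"
    using \<open>q > 1\<close> qn by simp
  then have "q ^ (s - 1) \<ge> q"
    by (simp add: s)
  show "1 \<le> beta_const k s"
    using pos \<open>q ^ (s - 1) \<ge> q\<close> \<open>q > 1\<close> unfolding beta by (simp add: le_divide_eq)
  have "(q ^ s + q - 2) / (q ^ s - q ^ (s - 1)) \<le> (q ^ s + q ^ (s - 1)) / (q ^ s - q ^ (s - 1))"
    using pos \<open>q ^ (s - 1) \<ge> q\<close> by (intro divide_right_mono) auto
  also have "\<dots> = 1 + 2 / (q - 1)"
    using \<open>q > 1\<close> by (simp add: s field_simps)
  finally show "beta_const k s \<le> sqrt (1 + 2 / ((2 * pi * of_int k)\<^sup>2 - 1))"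
    unfolding beta q_def[symmetric] by (rule real_sqrt_le_mono)
qed

lemma beta_const_numeric_bound:
  assumes "k \<noteq> 0"
  shows "sqrt (1 + 2 / ((2 * pi * of_int k)\<^sup>2 - 1)) \<le> 1.02566"
proof -
  have "1 + 2 / ((2 * pi * of_int k)\<^sup>2 - 1) \<le> 1 + 2 / (39.4783 - 1 :: real)"
    using four_pi_square_le[OF assms] by (intro add_left_mono divide_left_mono) auto
  also have "\<dots> \<le> 1.02566\<^sup>2"
    by (simp add: power2_eq_square)
  finally show ?thesis
    by (intro real_le_lsqrt) auto
qed

lemma tendsto_beta_const:
  assumes "s > 1"
  shows "((\<lambda>j::int. beta_const j s) \<longlongrightarrow> 1) at_top"
proof (rule tendsto_sandwich[where f = "\<lambda>_. 1"
      and h = "\<lambda>j. sqrt (1 + 2 / ((2 * pi * real_of_int j)\<^sup>2 - 1))"])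
  have "filterlim (\<lambda>j. 2 * pi * real_of_int j) at_top at_top"
    by (rule filterlim_tendsto_pos_mult_at_top[OF tendsto_const _ filterlim_real_of_int_at_top]) simp
  then have "filterlim (\<lambda>j. (2 * pi * real_of_int j)\<^sup>2 - 1) at_top at_top"
    using filterlim_tendsto_add_at_top[OF tendsto_const[of "- 1"] filterlim_pow_at_top[of 2]] by simp
  then have "((\<lambda>j. 2 / ((2 * pi * real_of_int j)\<^sup>2 - 1)) \<longlongrightarrow> 0) at_top"
    by (intro tendsto_divide_0[OF tendsto_const] filterlim_at_top_imp_at_infinity)
  then have "((\<lambda>j. sqrt (1 + 2 / ((2 * pi * real_of_int j)\<^sup>2 - 1))) \<longlongrightarrow> sqrt (1 + 0)) at_top"
    by (intro tendsto_intros)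
  then show "((\<lambda>j. sqrt (1 + 2 / ((2 * pi * real_of_int j)\<^sup>2 - 1))) \<longlongrightarrow> 1) at_top"
    by simp
  have nonzero: "eventually (\<lambda>j::int. j \<noteq> 0) at_top"
    using eventually_gt_at_top[of "0::int"] by eventually_elim simp
  show "eventually (\<lambda>j. 1 \<le> beta_const j s) at_top"
    using nonzero by eventually_elim (rule beta_const_bounds(1)[OF _ assms])
  show "eventually (\<lambda>j. beta_const j s \<le> sqrt (1 + 2 / ((2 * pi * real_of_int j)\<^sup>2 - 1))) at_top"
    using nonzero by eventually_elim (rule beta_const_bounds(2)[OF _ assms])
qed simp

lemma representer_norm_eq_beta_const:
  assumes "k \<noteq> 0" "s \<ge> 1"
  shows "sqrt (2 / (2 * pi * of_int k) ^ (2 * s) + (\<Sum>l = 1..s - 1. 1 / (2 * pi * of_int k) ^ (2 * l)))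
    = beta_const k s / (2 * pi * \<bar>of_int k\<bar>)"
proof -
  define q where "q = (2 * pi * real_of_int k)\<^sup>2"
  have "q > 1"
    using four_pi_square_le[OF \<open>k \<noteq> 0\<close>] by (simp add: q_def)
  have sqrt_q: "sqrt q = 2 * pi * \<bar>of_int k\<bar>"
    by (simp add: q_def abs_mult)
  show ?thesis
  proof (cases "s = 1")
    case True
    then show ?thesis
      by (simp add: beta_const_def real_sqrt_divide sqrt_q[symmetric] flip: q_def)
  next
    case False
    with \<open>s \<ge> 1\<close> have "s > 1"
      by simp
    then show ?thesis
      using geometric_norm_square[OF \<open>q > 1\<close> \<open>s > 1\<close>]
      by (simp add: beta_const_def power_mult real_sqrt_divide real_sqrt_mult sqrt_q[symmetric] flip: q_def)
  qed
qed

theorem proposition12: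
  fixes s :: nat and k :: int
  assumes "s \<ge> 1"
  shows
    "(k \<noteq> 0 \<longrightarrow>
       (let h = (\<lambda>x::real.
              1 / (2 * of_real pi * of_int k) ^ (2 * s) * exp (2 * of_real pi * \<i> * of_int k * of_real x)
              - (\<Sum>l = 1..s. (- 1) ^ l * (1 / (2 * of_real pi * \<i> * of_int k) ^ l)
                   * complex_of_real (normalized_bernoulli l x)))
        in (\<forall>g. is_representer k s g \<longleftrightarrow> (\<forall>x\<in>{0..1}. g x = h x)) \<and>
           initial_error k s = ereal (sobolev_norm s h) \<and>
           sobolev_norm s h
             = sqrt (2 / (2 * pi * of_int k) ^ (2 * s)
                 + (\<Sum>l = 1..s - 1. 1 / (2 * pi * of_int k) ^ (2 * l))) \<and>
           sobolev_norm s h = beta_const k s / (2 * pi * \<bar>of_int k\<bar>)) \<and>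
       (s = 1 \<longrightarrow> beta_const k s = sqrt 2) \<and>
       (s > 1 \<longrightarrow>
          1 \<le> beta_const k s \<and>
          beta_const k s
            = sqrt (((2 * pi * of_int k) ^ (2 * s) + (2 * pi * of_int k)\<^sup>2 - 2)
                / ((2 * pi * of_int k) ^ (2 * s) - (2 * pi * of_int k) ^ (2 * (s - 1)))) \<and>
          beta_const k s \<le> sqrt (1 + 2 / ((2 * pi * of_int k)\<^sup>2 - 1)) \<and>
          sqrt (1 + 2 / ((2 * pi * of_int k)\<^sup>2 - 1)) \<le> 1.02566)) \<and>
     (s > 1 \<longrightarrow> ((\<lambda>j::int. beta_const j s) \<longlongrightarrow> 1) at_top) \<and>
     (k = 0 \<longrightarrow>
       (\<forall>g. is_representer 0 s g \<longleftrightarrow> (\<forall>x\<in>{0..1}. g x = 1)) \<and>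
       initial_error 0 s = 1)"
proof (intro conjI impI)
  assume "k \<noteq> 0"
  let ?h = "\<lambda>x::real.
      1 / (2 * of_real pi * of_int k) ^ (2 * s) * exp (2 * of_real pi * \<i> * of_int k * of_real x)
      - (\<Sum>l = 1..s. (- 1) ^ l * (1 / (2 * of_real pi * \<i> * of_int k) ^ l)
           * complex_of_real (normalized_bernoulli l x))"
  have h: "?h = representer_deriv k s 0"
    by (simp add: fun_eq_iff representer_deriv_def angular_freq_def bernoulli_deriv_def)
  have rep: "is_representer k s ?h"
    unfolding h by (rule is_representer_bernoulli[OF \<open>k \<noteq> 0\<close> assms])
  have norm: "sobolev_norm s ?h = sqrt (2 / (2 * pi * of_int k) ^ (2 * s)
      + (\<Sum>l = 1..s - 1. 1 / (2 * pi * of_int k) ^ (2 * l)))"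
    unfolding h representer_norm_square[OF \<open>k \<noteq> 0\<close> assms, symmetric]
    using sobolev_norm_nonneg by simp
  have beta: "sobolev_norm s ?h = beta_const k s / (2 * pi * \<bar>of_int k\<bar>)"
    unfolding norm by (rule representer_norm_eq_beta_const[OF \<open>k \<noteq> 0\<close> assms])
  have "beta_const k s > 0"
  proof (cases "s = 1")
    case False
    with assms have "s > 1"
      by simp
    from beta_const_bounds(1)[OF \<open>k \<noteq> 0\<close> this] show ?thesis
      by simp
  qed (simp add: beta_const_def)
  then have "sobolev_norm s ?h > 0"
    unfolding beta using \<open>k \<noteq> 0\<close> by simp
  from initial_error_eq_representer_norm[OF rep assms this] representer_iff_eq_on[OF rep assms] norm beta
  show "let h = ?h in (\<forall>g. is_representer k s g \<longleftrightarrow> (\<forall>x\<in>{0..1}. g x = h x)) \<and>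
      initial_error k s = ereal (sobolev_norm s h) \<and>
      sobolev_norm s h = sqrt (2 / (2 * pi * of_int k) ^ (2 * s)
        + (\<Sum>l = 1..s - 1. 1 / (2 * pi * of_int k) ^ (2 * l))) \<and>
      sobolev_norm s h = beta_const k s / (2 * pi * \<bar>of_int k\<bar>)"
    unfolding Let_def by blast
next
  show "beta_const k s = sqrt (((2 * pi * of_int k) ^ (2 * s) + (2 * pi * of_int k)\<^sup>2 - 2)
      / ((2 * pi * of_int k) ^ (2 * s) - (2 * pi * of_int k) ^ (2 * (s - 1))))" if "s > 1"
    using that by (simp add: beta_const_def)
  show "\<forall>g. is_representer 0 s g \<longleftrightarrow> (\<forall>x\<in>{0..1}. g x = 1)"
    using representer_iff_eq_on[OF is_representer_const[OF assms] assms] by blast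
  show "initial_error 0 s = 1"
    using initial_error_eq_representer_norm[OF is_representer_const[OF assms] assms]
    by (simp add: sobolev_norm_const[OF assms] one_ereal_def)
qed (use beta_const_bounds beta_const_numeric_bound tendsto_beta_const in \<open>simp_all add: beta_const_def\<close>)

end
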